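(* Let $c=(c_t)_{t\in\mathbb{R}_+}$ be a strongly continuous contractive semigroup in the $W^*$-algebra $\mathcal{B}\subset\mathscr{B}(G)$. Then the strongly continuous product system (GNS-system) of the elementary CP-semigroup $b\mapsto c_t^*bc_t$ is the trivial one, with generating unit $c^\odot=(c_t)_{t\in\mathbb{R}_+}$.
   Context: $\mathcal{B}\subset\mathscr{B}(G)$ is a von Neumann algebra acting nondegenerately on a Hilbert space $G$. A strongly continuous contractive semigroup in $\mathcal{B}$ is a family of $c_t\in\mathcal{B}$ with $c_0=\mathbf{1}$, $c_sc_t=c_{s+t}$, $\|c_t\|\le1$ and $t\mapsto c_tg$ continuous for all $g\in G$. A $W^*$-correspondence over $\mathcal{B}$ is a self-dual Hilbert $\mathcal{B}$-module with a unital normal left action of $\mathcal{B}$ by adjointable operators; $\bar\odot$ is the self-dual extension of the interior tensor product. A product system of $W^*$-correspondences is a family $E^\odot=(E_t)_{t\in\mathbb{R}_+}$ of $W^*$-correspondences over $\mathcal{B}$ with $E_0=\mathcal{B}$ and bilinear unitaries $u_{s,t}\colon E_s\,\bar\odot\,E_t\to E_{s+t}$ such that $x_sy_t:=u_{s,t}(x_s\odot y_t)$ is associative and $u_{0,t},u_{t,0}$ are the canonical left and right action. A unit is a family $\xi^\odot=(\xi_t)$, $\xi_t\in E_t$, with $\xi_s\xi_t=\xi_{s+t}$, $\xi_0=\mathbf{1}$; it is generating if no proper product subsystem of $W^*$-correspondences contains it. The GNS-system of a normal CP-semigroup $T$ on $\mathcal{B}$ is the product system with a generating unit $\xi^\odot$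 fulfilling $T_t=\langle\xi_t,\bullet\,\xi_t\rangle$; it is unique up to unit preserving isomorphism. A strongly continuous structure on $E^\odot$ is given by isometric right $\mathcal{B}$-linear embeddings $i_t\colon E_t\to\hat E$ into a fixed self-dual Hilbert $\mathcal{B}$-module such that, calling sections $(x_t)$ with $t\mapsto i_tx_t\odot g\in\hat E\odot G$ continuous for all $g\in G$ strongly continuous, every element of every $E_s$ is the value at $s$ of a strongly continuous section, and $(s,t)\mapsto i_{s+t}(x_sy_t)\odot g$ is continuous for all strongly continuous sections $x,y$ and $g\in G$. The GNS-system of a strongly continuous contractive normal CP-semigroup carries the strongly continuous structure determined by the requirement that its generating unit be a strongly continuous section. The trivial product system is $E_t=\mathcal{B}$ for all $t$ (with its natural bimodule structure and $\langle b,b'\rangle=b^*b'$), with product $x_sy_t$ the multiplication of $\mathcal{B}$, and with strongly continuous sections the strongly continuous functions $\mathbb{R}_+\to\mathcal{B}\subset\mathscr{B}(G)$. *)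

theory Defs
  imports "HOL-Analysis.Analysis"
begin

section \<open>Complex Hilbert spaces and von Neumann algebras\<close>

text \<open>Inner products are linear in the second argument. Norm, metric and completeness are those
  of the underlying real Hilbert space, whose inner product is the real part of
  \<open>cinner\<close>.\<close>

class chilbert_space = real_inner + complete_space +
  fixes scaleC :: "complex \<Rightarrow> 'a \<Rightarrow> 'a"  (infixr "*\<^sub>C" 75)
    and cinner :: "'a \<Rightarrow> 'a \<Rightarrow> complex"
  assumes scaleC_add_right: "a *\<^sub>C (x + y) = a *\<^sub>C x + a *\<^sub>C y"
    and scaleC_add_left: "(a + b) *\<^sub>C x = a *\<^sub>C x + b *\<^sub>C x"
    and scaleC_scaleC: "a *\<^sub>C b *\<^sub>C x = (a * b) *\<^sub>C x"
    and scaleC_of_real: "complex_of_real r *\<^sub>C x = r *\<^sub>R x"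
    and cinner_commute: "cinner x y = cnj (cinner y x)"
    and cinner_add_right: "cinner x (y + z) = cinner x y + cinner x z"
    and cinner_scaleC_right: "cinner x (a *\<^sub>C y) = a * cinner x y"
    and Re_cinner: "Re (cinner x y) = inner x y"

instantiation complex :: chilbert_space
begin

definition scaleC_complex :: "complex \<Rightarrow> complex \<Rightarrow> complex"
  where "scaleC_complex a x = a * x"

definition cinner_complex :: "complex \<Rightarrow> complex \<Rightarrow> complex"
  where "cinner_complex x y = cnj x * y"

instance
  by standard
    (auto simp: scaleC_complex_def cinner_complex_def algebra_simps scaleR_conv_of_real
      inner_complex_def)

end

text \<open>Bounded operators on \<open>'g\<close> are the complex linear elements of the library type
  of bounded real linear maps; its norm is the operator norm.\<close>

definition clinear_op :: "('g::chilbert_space \<Rightarrow>\<^sub>L 'g) \<Rightarrow> bool"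
  where "clinear_op A \<longleftrightarrow> (\<forall>z x. A (z *\<^sub>C x) = z *\<^sub>C A x)"

definition scalar_op :: "complex \<Rightarrow> ('g::chilbert_space \<Rightarrow>\<^sub>L 'g)"
  where "scalar_op z = Blinfun (\<lambda>x. z *\<^sub>C x)"

definition is_adjoint :: "('g::chilbert_space \<Rightarrow>\<^sub>L 'g) \<Rightarrow> ('g \<Rightarrow>\<^sub>L 'g) \<Rightarrow> bool"
  where "is_adjoint A A' \<longleftrightarrow> (\<forall>x y. cinner x (A y) = cinner (A' x) y)"

definition adj :: "('g::chilbert_space \<Rightarrow>\<^sub>L 'g) \<Rightarrow> ('g \<Rightarrow>\<^sub>L 'g)"
  where "adj A = (THE A'. is_adjoint A A')"

definition positive_op :: "('g::chilbert_space \<Rightarrow>\<^sub>L 'g) \<Rightarrow> bool"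
  where "positive_op A \<longleftrightarrow> (\<forall>x. Im (cinner x (A x)) = 0 \<and> Re (cinner x (A x)) \<ge> 0)"

definition commutant :: "('g::chilbert_space \<Rightarrow>\<^sub>L 'g) set \<Rightarrow> ('g \<Rightarrow>\<^sub>L 'g) set"
  where "commutant S = {A. clinear_op A \<and> (\<forall>X\<in>S. A o\<^sub>L X = X o\<^sub>L A)}"

text \<open>A set of bounded operators that is closed under adjoints and equals its bicommutant; in
  particular it consists of complex linear operators and contains the identity, so that it acts
  nondegenerately.\<close>

definition von_neumann_algebra :: "('g::chilbert_space \<Rightarrow>\<^sub>L 'g) set \<Rightarrow> bool"
  where "von_neumann_algebra B \<longleftrightarrow>
    (\<forall>A\<in>B. \<exists>A'\<in>B. is_adjoint A A') \<and> commutant (commutant B) = B"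

definition sc_contractive_semigroup ::
    "('g::chilbert_space \<Rightarrow>\<^sub>L 'g) set \<Rightarrow> (real \<Rightarrow> 'g \<Rightarrow>\<^sub>L 'g) \<Rightarrow> bool"
  where "sc_contractive_semigroup B c \<longleftrightarrow>
    (\<forall>t\<ge>0. c t \<in> B \<and> norm (c t) \<le> 1) \<and> c 0 = id_blinfun \<and>
    (\<forall>s\<ge>0. \<forall>t\<ge>0. c (s + t) = c s o\<^sub>L c t) \<and>
    (\<forall>g. continuous_on {0..} (\<lambda>t. c t g))"

text \<open>The normal functionals are the \<open>\<sigma>\<close>-weakly continuous ones. A linear map is
  normal (\<open>\<sigma>\<close>-weakly continuous) iff it pulls normal functionals back to normal
  functionals.\<close>

definition normal_functional ::
    "('g::chilbert_space \<Rightarrow>\<^sub>L 'g) set \<Rightarrow> (('g \<Rightarrow>\<^sub>L 'g) \<Rightarrow> complex) \<Rightarrow> bool"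
  where "normal_functional B \<omega> \<longleftrightarrow>
    (\<exists>g h :: nat \<Rightarrow> 'g. summable (\<lambda>n. (norm (g n))\<^sup>2) \<and> summable (\<lambda>n. (norm (h n))\<^sup>2) \<and>
      (\<forall>b\<in>B. \<omega> b = (\<Sum>n. cinner (g n) (b (h n)))))"

definition normal_map ::
    "('g::chilbert_space \<Rightarrow>\<^sub>L 'g) set \<Rightarrow> (('g \<Rightarrow>\<^sub>L 'g) \<Rightarrow> ('g \<Rightarrow>\<^sub>L 'g)) \<Rightarrow> bool"
  where "normal_map B \<phi> \<longleftrightarrow>
    (\<forall>\<omega>. normal_functional B \<omega> \<longrightarrow> normal_functional B (\<lambda>b. \<omega> (\<phi> b)))"

definition completely_positive ::
    "('g::chilbert_space \<Rightarrow>\<^sub>L 'g) set \<Rightarrow> (('g \<Rightarrow>\<^sub>L 'g) \<Rightarrow> ('g \<Rightarrow>\<^sub>L 'g)) \<Rightarrow> bool"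
  where "completely_positive B \<phi> \<longleftrightarrow>
    (\<forall>b\<in>B. \<phi> b \<in> B) \<and>
    (\<forall>a\<in>B. \<forall>b\<in>B. \<phi> (a + b) = \<phi> a + \<phi> b) \<and>
    (\<forall>z. \<forall>b\<in>B. \<phi> (scalar_op z o\<^sub>L b) = scalar_op z o\<^sub>L \<phi> b) \<and>
    (\<forall>(n::nat) a b. (\<forall>i<n. a i \<in> B \<and> b i \<in> B) \<longrightarrow>
      positive_op (\<Sum>i<n. \<Sum>j<n. adj (b i) o\<^sub>L \<phi> (adj (a i) o\<^sub>L a j) o\<^sub>L b j))"

definition normal_CP_semigroup ::
    "('g::chilbert_space \<Rightarrow>\<^sub>L 'g) set \<Rightarrow> (real \<Rightarrow> ('g \<Rightarrow>\<^sub>L 'g) \<Rightarrow> ('g \<Rightarrow>\<^sub>L 'g)) \<Rightarrow> bool"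
  where "normal_CP_semigroup B T \<longleftrightarrow>
    (\<forall>t\<ge>0. completely_positive B (T t) \<and> normal_map B (T t)) \<and>
    (\<forall>b\<in>B. T 0 b = b) \<and>
    (\<forall>s\<ge>0. \<forall>t\<ge>0. \<forall>b\<in>B. T (s + t) b = T s (T t b))"

definition sc_contractive_normal_CP_semigroup ::
    "('g::chilbert_space \<Rightarrow>\<^sub>L 'g) set \<Rightarrow> (real \<Rightarrow> ('g \<Rightarrow>\<^sub>L 'g) \<Rightarrow> ('g \<Rightarrow>\<^sub>L 'g)) \<Rightarrow> bool"
  where "sc_contractive_normal_CP_semigroup B T \<longleftrightarrow>
    normal_CP_semigroup B T \<and>
    (\<forall>t\<ge>0. \<forall>b\<in>B. norm (T t b) \<le> norm b) \<and>
    (\<forall>b\<in>B. \<forall>g. continuous_on {0..} (\<lambda>t. T t b g))"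

definition elementary_CP ::
    "(real \<Rightarrow> 'g::chilbert_space \<Rightarrow>\<^sub>L 'g) \<Rightarrow> real \<Rightarrow> ('g \<Rightarrow>\<^sub>L 'g) \<Rightarrow> ('g \<Rightarrow>\<^sub>L 'g)"
  where "elementary_CP c t b = adj (c t) o\<^sub>L b o\<^sub>L c t"


section \<open>Self-dual Hilbert modules and $W^*$-correspondences\<close>

text \<open>A module is carried by an additive subgroup of \<open>'e\<close>. Its complex scalar
  multiplication is the right action of the scalar operators, which belong to the algebra.\<close>

record (overloaded) ('e, 'g::chilbert_space) hmod =
  carr :: "'e set"
  ract :: "'e \<Rightarrow> ('g \<Rightarrow>\<^sub>L 'g) \<Rightarrow> 'e"
  ip :: "'e \<Rightarrow> 'e \<Rightarrow> ('g \<Rightarrow>\<^sub>L 'g)"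

record (overloaded) ('e, 'g::chilbert_space) corr = "('e, 'g) hmod" +
  lact :: "('g \<Rightarrow>\<^sub>L 'g) \<Rightarrow> 'e \<Rightarrow> 'e"

definition mnorm :: "('e, 'g::chilbert_space, 'z) hmod_scheme \<Rightarrow> 'e \<Rightarrow> real"
  where "mnorm M x = sqrt (norm (ip M x x))"

definition hilbert_module ::
    "('g::chilbert_space \<Rightarrow>\<^sub>L 'g) set \<Rightarrow> ('e::ab_group_add, 'g, 'z) hmod_scheme \<Rightarrow> bool"
  where "hilbert_module B M \<longleftrightarrow>
    0 \<in> carr M \<and> (\<forall>x\<in>carr M. \<forall>y\<in>carr M. x + y \<in> carr M \<and> x - y \<in> carr M) \<and>
    (\<forall>x\<in>carr M. \<forall>b\<in>B. ract M x b \<in> carr M) \<and>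
    (\<forall>x\<in>carr M. ract M x id_blinfun = x) \<and>
    (\<forall>x\<in>carr M. \<forall>a\<in>B. \<forall>b\<in>B. ract M (ract M x a) b = ract M x (a o\<^sub>L b) \<and>
      ract M x (a + b) = ract M x a + ract M x b) \<and>
    (\<forall>x\<in>carr M. \<forall>y\<in>carr M. \<forall>b\<in>B. ract M (x + y) b = ract M x b + ract M y b) \<and>
    (\<forall>x\<in>carr M. \<forall>y\<in>carr M. ip M x y \<in> B \<and> is_adjoint (ip M x y) (ip M y x)) \<and>
    (\<forall>x\<in>carr M. \<forall>y\<in>carr M. \<forall>z\<in>carr M. ip M x (y + z) = ip M x y + ip M x z) \<and>
    (\<forall>x\<in>carr M. \<forall>y\<in>carr M. \<forall>b\<in>B. ip M x (ract M y b) = ip M x y o\<^sub>L b) \<and>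
    (\<forall>x\<in>carr M. positive_op (ip M x x) \<and> (ip M x x = 0 \<longrightarrow> x = 0)) \<and>
    (\<forall>f :: nat \<Rightarrow> 'e. (\<forall>n. f n \<in> carr M) \<and>
      (\<forall>\<epsilon>>0. \<exists>N. \<forall>m\<ge>N. \<forall>n\<ge>N. mnorm M (f m - f n) < \<epsilon>) \<longrightarrow>
      (\<exists>x\<in>carr M. (\<lambda>n. mnorm M (f n - x)) \<longlonglongrightarrow> 0))"

definition closed_submodule ::
    "('g::chilbert_space \<Rightarrow>\<^sub>L 'g) set \<Rightarrow> ('e::ab_group_add, 'g, 'z) hmod_scheme \<Rightarrow> 'e set \<Rightarrow> bool"
  where "closed_submodule B M X \<longleftrightarrow>
    X \<subseteq> carr M \<and> 0 \<in> X \<and> (\<forall>x\<in>X. \<forall>y\<in>X. x + y \<in> X \<and> x - y \<in> X) \<and>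
    (\<forall>x\<in>X. \<forall>b\<in>B. ract M x b \<in> X) \<and>
    (\<forall>f x. (\<forall>n::nat. f n \<in> X) \<and> x \<in> carr M \<and> (\<lambda>n. mnorm M (f n - x)) \<longlonglongrightarrow> 0 \<longrightarrow> x \<in> X)"

definition closed_span ::
    "('g::chilbert_space \<Rightarrow>\<^sub>L 'g) set \<Rightarrow> ('e::ab_group_add, 'g, 'z) hmod_scheme \<Rightarrow> 'e set \<Rightarrow> 'e set"
  where "closed_span B M S = \<Inter>{X. closed_submodule B M X \<and> S \<subseteq> X}"

definition bounded_right_linear ::
    "('g::chilbert_space \<Rightarrow>\<^sub>L 'g) set \<Rightarrow> ('e::ab_group_add, 'g, 'z) hmod_scheme \<Rightarrow> 'e set \<Rightarrow>
      ('e \<Rightarrow> ('g \<Rightarrow>\<^sub>L 'g)) \<Rightarrow> bool"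
  where "bounded_right_linear B M X \<Phi> \<longleftrightarrow>
    (\<forall>x\<in>X. \<Phi> x \<in> B) \<and> (\<forall>x\<in>X. \<forall>y\<in>X. \<Phi> (x + y) = \<Phi> x + \<Phi> y) \<and>
    (\<forall>x\<in>X. \<forall>b\<in>B. \<Phi> (ract M x b) = \<Phi> x o\<^sub>L b) \<and>
    (\<exists>K. \<forall>x\<in>X. norm (\<Phi> x) \<le> K * mnorm M x)"

definition self_dual ::
    "('g::chilbert_space \<Rightarrow>\<^sub>L 'g) set \<Rightarrow> ('e::ab_group_add, 'g, 'z) hmod_scheme \<Rightarrow> bool"
  where "self_dual B M \<longleftrightarrow>
    (\<forall>\<Phi>. bounded_right_linear B M (carr M) \<Phi> \<longrightarrow>
      (\<exists>y\<in>carr M. \<forall>x\<in>carr M. \<Phi> x = ip M y x))"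

text \<open>Paschke's self-dual extension of a Hilbert module \<open>X\<close> is the module of all bounded
  right linear maps from \<open>X\<close> to the algebra, \<open>X\<close> being embedded by its inner
  product. Accordingly, a self-dual \<open>M\<close> containing \<open>X\<close> is the self-dual
  extension of \<open>X\<close> iff assigning to \<open>y\<close> the restriction of
  \<open>ip M y\<close> to \<open>X\<close> is a bijection from \<open>M\<close> onto these maps.\<close>

definition self_dual_extension ::
    "('g::chilbert_space \<Rightarrow>\<^sub>L 'g) set \<Rightarrow> ('e::ab_group_add, 'g, 'z) hmod_scheme \<Rightarrow> 'e set \<Rightarrow> bool"
  where "self_dual_extension B M X \<longleftrightarrow>
    hilbert_module B M \<and> self_dual B M \<and> closed_submodule B M X \<and>
    (\<forall>\<Phi>. bounded_right_linear B M X \<Phi> \<longrightarrow>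
      (\<exists>!y. y \<in> carr M \<and> (\<forall>x\<in>X. \<Phi> x = ip M y x)))"

definition W_correspondence ::
    "('g::chilbert_space \<Rightarrow>\<^sub>L 'g) set \<Rightarrow> ('e::ab_group_add, 'g) corr \<Rightarrow> bool"
  where "W_correspondence B E \<longleftrightarrow>
    hilbert_module B E \<and> self_dual B E \<and>
    (\<forall>b\<in>B. \<forall>x\<in>carr E. lact E b x \<in> carr E) \<and>
    (\<forall>x\<in>carr E. lact E id_blinfun x = x) \<and>
    (\<forall>a\<in>B. \<forall>b\<in>B. \<forall>x\<in>carr E. lact E (a o\<^sub>L b) x = lact E a (lact E b x) \<and>
      lact E (a + b) x = lact E a x + lact E b x) \<and>
    (\<forall>z. \<forall>x\<in>carr E. lact E (scalar_op z) x = ract E x (scalar_op z)) \<and>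
    (\<forall>b\<in>B. \<forall>x\<in>carr E. \<forall>y\<in>carr E. lact E b (x + y) = lact E b x + lact E b y \<and>
      ip E (lact E b x) y = ip E x (lact E (adj b) y)) \<and>
    (\<forall>b\<in>B. \<forall>x\<in>carr E. \<forall>a\<in>B. lact E b (ract E x a) = ract E (lact E b x) a) \<and>
    (\<forall>x\<in>carr E. \<forall>y\<in>carr E. normal_map B (\<lambda>b. ip E x (lact E b y)))"

definition isometric_embedding ::
    "('g::chilbert_space \<Rightarrow>\<^sub>L 'g) set \<Rightarrow> ('e::ab_group_add, 'g, 'y) hmod_scheme \<Rightarrow>
      ('f::ab_group_add, 'g, 'z) hmod_scheme \<Rightarrow> ('e \<Rightarrow> 'f) \<Rightarrow> bool"
  where "isometric_embedding B M N v \<longleftrightarrow>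
    (\<forall>x\<in>carr M. v x \<in> carr N) \<and>
    (\<forall>x\<in>carr M. \<forall>y\<in>carr M. v (x + y) = v x + v y \<and> ip N (v x) (v y) = ip M x y) \<and>
    (\<forall>x\<in>carr M. \<forall>b\<in>B. v (ract M x b) = ract N (v x) b)"

definition bilinear_unitary ::
    "('g::chilbert_space \<Rightarrow>\<^sub>L 'g) set \<Rightarrow> ('e::ab_group_add, 'g) corr \<Rightarrow>
      ('f::ab_group_add, 'g) corr \<Rightarrow> ('e \<Rightarrow> 'f) \<Rightarrow> bool"
  where "bilinear_unitary B E F u \<longleftrightarrow>
    isometric_embedding B E F u \<and> u ` carr E = carr F \<and>
    (\<forall>b\<in>B. \<forall>x\<in>carr E. u (lact E b x) = lact F b (u x))"

text \<open>\<open>P\<close> with the elementary tensors \<open>tens x y\<close> is the self-dual interior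
  tensor product of \<open>E\<close> and \<open>F\<close>. The interior tensor product itself is the
  Hilbert module generated by the elementary tensors with the given inner products; the inner
  products make \<open>tens\<close> biadditive, balanced and right linear.\<close>

definition is_sd_tensor ::
    "('g::chilbert_space \<Rightarrow>\<^sub>L 'g) set \<Rightarrow> ('e::ab_group_add, 'g) corr \<Rightarrow>
      ('f::ab_group_add, 'g) corr \<Rightarrow> ('p::ab_group_add, 'g) corr \<Rightarrow> ('e \<Rightarrow> 'f \<Rightarrow> 'p) \<Rightarrow> bool"
  where "is_sd_tensor B E F P tens \<longleftrightarrow>
    W_correspondence B P \<and>
    (\<forall>x\<in>carr E. \<forall>y\<in>carr F. tens x y \<in> carr P) \<and>
    (\<forall>x\<in>carr E. \<forall>y\<in>carr F. \<forall>x'\<in>carr E. \<forall>y'\<in>carr F.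
      ip P (tens x y) (tens x' y') = ip F y (lact F (ip E x x') y')) \<and>
    (\<forall>b\<in>B. \<forall>x\<in>carr E. \<forall>y\<in>carr F. lact P b (tens x y) = tens (lact E b x) y) \<and>
    self_dual_extension B P (closed_span B P {tens x y |x y. x \<in> carr E \<and> y \<in> carr F})"

text \<open>The tensor product of a Hilbert module \<open>M\<close> with the representation space, realized
  as the whole type \<open>'k\<close>. The set of elementary tensors is invariant under complex
  scalars, so that its real span is a complex subspace.\<close>

definition is_hilbert_tensor ::
    "('e::ab_group_add, 'g::chilbert_space, 'z) hmod_scheme \<Rightarrow>
      ('e \<Rightarrow> 'g \<Rightarrow> 'k::chilbert_space) \<Rightarrow> bool"
  where "is_hilbert_tensor M tens \<longleftrightarrow>
    (\<forall>x\<in>carr M. \<forall>y\<in>carr M. \<forall>g h. cinner (tens x g) (tens y h) = cinner g (ip M x y h)) \<and>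
    closure (span {tens x g |x g. x \<in> carr M}) = UNIV"

definition trivial_corr ::
    "('g::chilbert_space \<Rightarrow>\<^sub>L 'g) set \<Rightarrow> ('g \<Rightarrow>\<^sub>L 'g, 'g) corr"
  where "trivial_corr B =
    \<lparr>carr = B, ract = (\<lambda>x b. x o\<^sub>L b), ip = (\<lambda>x y. adj x o\<^sub>L y), lact = (\<lambda>b x. b o\<^sub>L x)\<rparr>"


section \<open>Product systems\<close>

text \<open>Families are functions on the reals of which only the values at nonnegative times matter.
  \<open>mul s t x y\<close> is the product of \<open>x\<close> in \<open>fib s\<close> and
  \<open>y\<close> in \<open>fib t\<close>; \<open>emb0\<close> is the identification of the algebra
  with the fibre at time 0.\<close>

record (overloaded) ('e, 'g::chilbert_space) psys =
  fib :: "real \<Rightarrow> ('e, 'g) corr"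
  mul :: "real \<Rightarrow> real \<Rightarrow> 'e \<Rightarrow> 'e \<Rightarrow> 'e"
  emb0 :: "('g \<Rightarrow>\<^sub>L 'g) \<Rightarrow> 'e"

text \<open>The unitaries \<open>u\<close> act on a realization \<open>P\<close> of the self-dual tensor
  product. Since \<open>P\<close> is isomorphic to \<open>fib E (s + t)\<close>, taking it over the same
  type \<open>'e\<close> is no restriction.\<close>

definition product_system ::
    "('g::chilbert_space \<Rightarrow>\<^sub>L 'g) set \<Rightarrow> ('e::ab_group_add, 'g) psys \<Rightarrow> bool"
  where "product_system B E \<longleftrightarrow>
    (\<forall>t\<ge>0. W_correspondence B (fib E t)) \<and>
    bilinear_unitary B (trivial_corr B) (fib E 0) (emb0 E) \<and>
    (\<forall>s\<ge>0. \<forall>t\<ge>0. \<exists>(P :: ('e, 'g) corr) tens u.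
      is_sd_tensor B (fib E s) (fib E t) P tens \<and>
      bilinear_unitary B P (fib E (s + t)) u \<and>
      (\<forall>x\<in>carr (fib E s). \<forall>y\<in>carr (fib E t). mul E s t x y = u (tens x y))) \<and>
    (\<forall>r\<ge>0. \<forall>s\<ge>0. \<forall>t\<ge>0. \<forall>x\<in>carr (fib E r). \<forall>y\<in>carr (fib E s). \<forall>z\<in>carr (fib E t).
      mul E (r + s) t (mul E r s x y) z = mul E r (s + t) x (mul E s t y z)) \<and>
    (\<forall>t\<ge>0. \<forall>x\<in>carr (fib E t). \<forall>b\<in>B.
      mul E 0 t (emb0 E b) x = lact (fib E t) b x \<and>
      mul E t 0 x (emb0 E b) = ract (fib E t) x b)"

definition product_unit ::
    "('e::ab_group_add, 'g::chilbert_space) psys \<Rightarrow> (real \<Rightarrow> 'e) \<Rightarrow> bool"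
  where "product_unit E \<xi> \<longleftrightarrow>
    (\<forall>t\<ge>0. \<xi> t \<in> carr (fib E t)) \<and> \<xi> 0 = emb0 E id_blinfun \<and>
    (\<forall>s\<ge>0. \<forall>t\<ge>0. mul E s t (\<xi> s) (\<xi> t) = \<xi> (s + t))"

definition product_subsystem ::
    "('g::chilbert_space \<Rightarrow>\<^sub>L 'g) set \<Rightarrow> ('e::ab_group_add, 'g) psys \<Rightarrow> (real \<Rightarrow> 'e set) \<Rightarrow> bool"
  where "product_subsystem B E F \<longleftrightarrow>
    (\<forall>t\<ge>0. F t \<subseteq> carr (fib E t)) \<and>
    product_system B (E\<lparr>fib := (\<lambda>t. (fib E t)\<lparr>carr := F t\<rparr>)\<rparr>)"

definition generating ::
    "('g::chilbert_space \<Rightarrow>\<^sub>L 'g) set \<Rightarrow> ('e::ab_group_add, 'g) psys \<Rightarrow> (real \<Rightarrow> 'e) \<Rightarrow> bool"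
  where "generating B E \<xi> \<longleftrightarrow>
    (\<forall>F. product_subsystem B E F \<and> (\<forall>t\<ge>0. \<xi> t \<in> F t) \<longrightarrow> (\<forall>t\<ge>0. F t = carr (fib E t)))"

definition GNS_system ::
    "('g::chilbert_space \<Rightarrow>\<^sub>L 'g) set \<Rightarrow> (real \<Rightarrow> ('g \<Rightarrow>\<^sub>L 'g) \<Rightarrow> ('g \<Rightarrow>\<^sub>L 'g)) \<Rightarrow>
      ('e::ab_group_add, 'g) psys \<Rightarrow> (real \<Rightarrow> 'e) \<Rightarrow> bool"
  where "GNS_system B T E \<xi> \<longleftrightarrow>
    normal_CP_semigroup B T \<and> product_system B E \<and> product_unit E \<xi> \<and> generating B E \<xi> \<and>
    (\<forall>t\<ge>0. \<forall>b\<in>B. T t b = ip (fib E t) (\<xi> t) (lact (fib E t) b (\<xi> t)))"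


section \<open>Strongly continuous structures\<close>

text \<open>The embeddings \<open>iemb t\<close> map into the module \<open>amb\<close>; the type
  \<open>'k\<close> with \<open>atens\<close> is the tensor product of \<open>amb\<close> with the
  representation space.\<close>

record (overloaded) ('e, 'h, 'g::chilbert_space, 'k) sc_struct =
  amb :: "('h, 'g) hmod"
  iemb :: "real \<Rightarrow> 'e \<Rightarrow> 'h"
  atens :: "'h \<Rightarrow> 'g \<Rightarrow> 'k"

definition sc_sections ::
    "('e::ab_group_add, 'g::chilbert_space) psys \<Rightarrow>
      ('e, 'h::ab_group_add, 'g, 'k::chilbert_space) sc_struct \<Rightarrow> (real \<Rightarrow> 'e) set"
  where "sc_sections E S =
    {x. (\<forall>t\<ge>0. x t \<in> carr (fib E t)) \<and>
        (\<forall>g. continuous_on {0..} (\<lambda>t. atens S (iemb S t (x t)) g))}"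

definition sc_structure ::
    "('g::chilbert_space \<Rightarrow>\<^sub>L 'g) set \<Rightarrow> ('e::ab_group_add, 'g) psys \<Rightarrow>
      ('e, 'h::ab_group_add, 'g, 'k::chilbert_space) sc_struct \<Rightarrow> bool"
  where "sc_structure B E S \<longleftrightarrow>
    hilbert_module B (amb S) \<and> self_dual B (amb S) \<and> is_hilbert_tensor (amb S) (atens S) \<and>
    (\<forall>t\<ge>0. isometric_embedding B (fib E t) (amb S) (iemb S t)) \<and>
    (\<forall>s\<ge>0. \<forall>y\<in>carr (fib E s). \<exists>x\<in>sc_sections E S. x s = y) \<and>
    (\<forall>x\<in>sc_sections E S. \<forall>y\<in>sc_sections E S. \<forall>g.
      continuous_on ({0..} \<times> {0..})
        (\<lambda>(s, t). atens S (iemb S (s + t) (mul E s t (x s) (y t))) g))"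

definition sc_GNS_system ::
    "('g::chilbert_space \<Rightarrow>\<^sub>L 'g) set \<Rightarrow> (real \<Rightarrow> ('g \<Rightarrow>\<^sub>L 'g) \<Rightarrow> ('g \<Rightarrow>\<^sub>L 'g)) \<Rightarrow>
      ('e::ab_group_add, 'g) psys \<Rightarrow> (real \<Rightarrow> 'e) \<Rightarrow>
      ('e, 'h::ab_group_add, 'g, 'k::chilbert_space) sc_struct \<Rightarrow> bool"
  where "sc_GNS_system B T E \<xi> S \<longleftrightarrow>
    sc_contractive_normal_CP_semigroup B T \<and> GNS_system B T E \<xi> \<and>
    sc_structure B E S \<and> \<xi> \<in> sc_sections E S"


section \<open>The trivial product system\<close>

definition trivial_system ::
    "('g::chilbert_space \<Rightarrow>\<^sub>L 'g) set \<Rightarrow> ('g \<Rightarrow>\<^sub>L 'g, 'g) psys"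
  where "trivial_system B =
    \<lparr>fib = (\<lambda>t. trivial_corr B), mul = (\<lambda>s t x y. x o\<^sub>L y), emb0 = (\<lambda>b. b)\<rparr>"

text \<open>All fibres are embedded identically into the algebra, whose tensor product with the
  representation space is that space itself, the elementary tensors being \<open>b g\<close>.\<close>

definition trivial_sc_struct ::
    "('g::chilbert_space \<Rightarrow>\<^sub>L 'g) set \<Rightarrow> ('g \<Rightarrow>\<^sub>L 'g, 'g \<Rightarrow>\<^sub>L 'g, 'g, 'g) sc_struct"
  where "trivial_sc_struct B =
    \<lparr>amb = hmod.truncate (trivial_corr B), iemb = (\<lambda>t x. x), atens = (\<lambda>b g. b g)\<rparr>"

definition sc_functions ::
    "('g::chilbert_space \<Rightarrow>\<^sub>L 'g) set \<Rightarrow> (real \<Rightarrow> 'g \<Rightarrow>\<^sub>L 'g) set"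
  where "sc_functions B =
    {x. (\<forall>t\<ge>0. x t \<in> B) \<and> (\<forall>g. continuous_on {0..} (\<lambda>t. x t g))}"

end

theory Submission
  imports Defs
begin

text \<open>
  With \<open>\<langle>x, y\<rangle> = x\<^sup>* y\<close> on \<open>B\<close>, the element \<open>c t\<close> of the fibre \<open>B\<close>
  gives \<open>\<langle>c t, b (c t)\<rangle> = (c t)\<^sup>* b (c t)\<close>, so \<open>c\<close> is a unit of the trivial product
  system that implements the elementary semigroup. Three points need an argument.

  Strong continuity of the semigroup rests on that of \<open>t \<mapsto> (c t)\<^sup>*\<close>, which is not
  automatic, as taking adjoints is not strongly continuous. For contractions, however,
  \<open>\<parallel>(c h)\<^sup>* g - g\<parallel>\<^sup>2 \<le> 2 Re \<langle>g, g - c h g\<rangle>\<close>, and the semigroup law transports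
  continuity from time 0 to all times (\<open>adjoint_semigroup_strongly_continuous\<close>).

  The unit is generating (\<open>generating_trivial_system\<close>). In a product subsystem
  \<open>F\<close>, self-duality of \<open>F t\<close> represents the inclusion of \<open>F t\<close> into
  \<open>B\<close> by an element of \<open>F t\<close>, which is a projection \<open>p t\<close> with
  \<open>F t = p t B\<close>. Being idempotent, \<open>p (s / n)\<close> equals its \<open>n\<close>-th power and hence lies in
  \<open>F s\<close>; so does \<open>c (s / n) = p (s / n) c (s / n)\<close>. Therefore
  \<open>p s c (s / n) = c (s / n)\<close>, and \<open>n \<rightarrow> \<infinity>\<close> gives \<open>p s = 1\<close>, that is,
  \<open>F s = B\<close>.

  The strongly continuous structure is determined by \<open>c\<close>
  (\<open>sc_sections_unique\<close>). An arbitrary structure provides isometries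
  \<open>V t g = i\<^sub>t 1 \<odot> g\<close> with \<open>i\<^sub>t x \<odot> g = V t (x g)\<close>, and its sections are the strongly
  continuous functions as soon as \<open>V\<close> is strongly continuous. Near a time \<open>s\<close> one takes
  a section \<open>x\<close> with \<open>x s = 1\<close> and uses that \<open>V (r + t) (x r c t g)\<close> is jointly continuous:
  on the line \<open>r + t = s\<close> this shows that \<open>x r \<rightarrow> 1\<close> strongly as \<open>r\<close> increases to
  \<open>s\<close>, and along \<open>r + t \<rightarrow> s\<close> with \<open>t \<rightarrow> 0\<close> it then shows that
  \<open>V\<close> is continuous at \<open>s\<close>.

  Limits of products of strongly convergent sequences of operators rest on the uniform boundedness
  principle (\<open>banach_steinhaus_sequence\<close>, \<open>strong_limit_apply\<close>).
\<close>

instance chilbert_space \<subseteq> banach ..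

section \<open>Hilbert space operators and their adjoints\<close>

lemma cinner_add_left: "cinner (x + y) z = cinner x z + cinner y z"
  using cinner_add_right[of z x y] cinner_commute[of "x + y" z] cinner_commute[of x z]
    cinner_commute[of y z] by simp

lemma cinner_scaleC_left: "cinner (a *\<^sub>C x) z = cnj a * cinner x z"
  using cinner_scaleC_right[of z a x] cinner_commute[of "a *\<^sub>C x" z] cinner_commute[of x z]
  by simp

lemma cinner_self: "cinner x x = complex_of_real ((norm x)\<^sup>2)"
proof (rule complex_eqI)
  show "Re (cinner x x) = Re (complex_of_real ((norm x)\<^sup>2))"
    by (simp add: Re_cinner power2_norm_eq_inner)
  have "Im (cinner x x) = - Im (cinner x x)"
    using arg_cong[OF cinner_commute[of x x], of Im] by simp
  then show "Im (cinner x x) = Im (complex_of_real ((norm x)\<^sup>2))" by simp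
qed

lemma cinner_eqI:
  assumes "\<And>z. cinner z x = cinner z y"
  shows "x = y"
proof -
  have "inner (x - y) x = inner (x - y) y"
    using arg_cong[OF assms[of "x - y"], of Re] by (simp add: Re_cinner)
  then have "inner (x - y) (x - y) = 0" by (simp add: inner_diff_right)
  then show ?thesis by simp
qed

lemma norm_diff_eq_if_cinner_eq:
  assumes "cinner a a = cinner a' a'" "cinner a b = cinner a' b'" "cinner b b = cinner b' b'"
  shows "norm (a - b) = norm (a' - b')"
proof -
  have "inner a a = inner a' a'" "inner a b = inner a' b'" "inner b b = inner b' b'"
    using assms[THEN arg_cong, of Re] by (simp_all add: Re_cinner)
  then show ?thesis
    by (simp add: norm_eq_sqrt_inner inner_diff_left inner_diff_right inner_commute)
qed

lemma norm_scaleC: "norm (a *\<^sub>C x) = cmod a * norm x" for x :: "'g::chilbert_space"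
proof -
  have "complex_of_real ((norm (a *\<^sub>C x))\<^sup>2) = a * cnj a * cinner x x"
    unfolding cinner_self[symmetric] by (simp add: cinner_scaleC_left cinner_scaleC_right)
  also have "\<dots> = complex_of_real ((cmod a * norm x)\<^sup>2)"
    by (simp only: cinner_self complex_norm_square[symmetric] of_real_mult[symmetric]
        power_mult_distrib of_real_power[symmetric])
  finally have "(norm (a *\<^sub>C x))\<^sup>2 = (cmod a * norm x)\<^sup>2"
    by (simp only: of_real_eq_iff)
  then show ?thesis by (simp add: power2_eq_iff_nonneg)
qed

lemma bounded_linear_scaleC: "bounded_linear (\<lambda>x :: 'g::chilbert_space. a *\<^sub>C x)"
proof (rule bounded_linear_intro)
  show "a *\<^sub>C (r *\<^sub>R x) = r *\<^sub>R (a *\<^sub>C x)" for r and x :: 'g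
    by (simp add: scaleC_of_real[symmetric] scaleC_scaleC mult.commute)
  show "norm (a *\<^sub>C x) \<le> norm x * cmod a" for x :: 'g
    by (simp add: norm_scaleC)
qed (rule scaleC_add_right)

lemma scaleC_zero_right [simp]: "a *\<^sub>C (0 :: 'g::chilbert_space) = 0"
  by (rule linear_0[OF bounded_linear.linear[OF bounded_linear_scaleC]])

lemma scaleC_minus_right: "a *\<^sub>C (- x :: 'g::chilbert_space) = - (a *\<^sub>C x)"
  by (rule linear_neg[OF bounded_linear.linear[OF bounded_linear_scaleC]])

lemma scalar_op_apply [simp]: "scalar_op z x = z *\<^sub>C x"
  unfolding scalar_op_def by (simp add: bounded_linear_Blinfun_apply bounded_linear_scaleC)

lemma blinfun_eq_iff: "A = X \<longleftrightarrow> (\<forall>g. blinfun_apply A g = blinfun_apply X g)"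
  by (auto intro: blinfun_eqI)

lemma blinfun_compose_assoc: "(A o\<^sub>L X) o\<^sub>L C = A o\<^sub>L (X o\<^sub>L C)"
  by (rule blinfun_eqI) simp

lemma compose_id [simp]: "id_blinfun o\<^sub>L A = A" "A o\<^sub>L id_blinfun = A"
  by (simp_all add: blinfun_eq_iff)

lemma compose_add_left: "(A + X) o\<^sub>L C = (A o\<^sub>L C) + (X o\<^sub>L C)"
  by (simp add: blinfun_eq_iff blinfun.add_left)

lemma compose_add_right: "A o\<^sub>L (X + C) = (A o\<^sub>L X) + (A o\<^sub>L C)"
  by (simp add: blinfun_eq_iff blinfun.add_left blinfun.add_right)

lemma is_adjoint_sym:
  assumes "is_adjoint A A'"
  shows "is_adjoint A' A"
  unfolding is_adjoint_def
proof (intro allI)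
  fix x y
  have "cinner x (A' y) = cnj (cinner (A' y) x)" by (rule cinner_commute)
  also have "\<dots> = cnj (cinner y (A x))" using assms by (simp add: is_adjoint_def)
  also have "\<dots> = cinner (A x) y" by (rule cinner_commute[symmetric])
  finally show "cinner x (A' y) = cinner (A x) y" .
qed

lemma is_adjoint_unique:
  assumes "is_adjoint A A'" "is_adjoint A A''"
  shows "A' = A''"
proof (rule blinfun_eqI, rule cinner_eqI)
  show "cinner z (A' x) = cinner z (A'' x)" for x z
    using assms[THEN is_adjoint_sym] by (simp add: is_adjoint_def)
qed

lemma adj_eqI: "is_adjoint A A' \<Longrightarrow> adj A = A'"
  unfolding adj_def by (rule the_equality) (auto intro: is_adjoint_unique)

lemma is_adjoint_compose:
  "is_adjoint A A' \<Longrightarrow> is_adjoint X X' \<Longrightarrow> is_adjoint (A o\<^sub>L X) (X' o\<^sub>L A')"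
  unfolding is_adjoint_def by simp

lemma is_adjoint_inner: "is_adjoint A A' \<Longrightarrow> inner x (A y) = inner (A' x) y"
  unfolding is_adjoint_def Re_cinner[symmetric] by simp

lemma norm_adjoint_le:
  assumes "is_adjoint A A'"
  shows "norm A' \<le> norm A"
proof (rule norm_blinfun_bound)
  fix x
  have "(norm (A' x))\<^sup>2 = inner x (A (A' x))"
    using is_adjoint_inner[OF assms] by (simp add: power2_norm_eq_inner)
  also have "\<dots> \<le> norm x * norm (A (A' x))"
    by (rule norm_cauchy_schwarz)
  also have "\<dots> \<le> norm x * (norm A * norm (A' x))"
    by (intro mult_left_mono norm_blinfun) simp
  finally have "norm (A' x) * norm (A' x) \<le> (norm A * norm x) * norm (A' x)"
    by (simp add: power2_eq_square mult_ac)
  then show "norm (A' x) \<le> norm A * norm x"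
    by (cases "norm (A' x) = 0") auto
qed simp

text \<open>The \<open>C\<^sup>*\<close>-identity. It makes the module norm of an algebra, seen as a module over itself,
  its operator norm.\<close>

lemma norm_adjoint_compose:
  assumes "is_adjoint A A'"
  shows "norm (A' o\<^sub>L A) = (norm A)\<^sup>2"
proof (rule antisym)
  have "norm (A' o\<^sub>L A) \<le> norm A' * norm A" by (rule norm_blinfun_compose)
  also have "\<dots> \<le> norm A * norm A"
    by (intro mult_right_mono norm_adjoint_le[OF assms]) simp
  finally show "norm (A' o\<^sub>L A) \<le> (norm A)\<^sup>2" by (simp add: power2_eq_square)
  have "norm A \<le> sqrt (norm (A' o\<^sub>L A))"
  proof (rule norm_blinfun_bound)
    fix x
    have "(norm (A x))\<^sup>2 = inner (A x) (A x)" by (simp add: power2_norm_eq_inner)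
    also have "\<dots> = inner x (A' (A x))"
      using is_adjoint_inner[OF is_adjoint_sym[OF assms]] by simp
    also have "\<dots> \<le> norm x * norm ((A' o\<^sub>L A) x)"
      using norm_cauchy_schwarz by simp
    also have "\<dots> \<le> norm x * (norm (A' o\<^sub>L A) * norm x)"
      by (intro mult_left_mono norm_blinfun) simp
    finally have "(norm (A x))\<^sup>2 \<le> norm (A' o\<^sub>L A) * (norm x)\<^sup>2"
      by (simp add: power2_eq_square mult_ac)
    then have "sqrt ((norm (A x))\<^sup>2) \<le> sqrt (norm (A' o\<^sub>L A) * (norm x)\<^sup>2)"
      by (rule real_sqrt_le_mono)
    then show "norm (A x) \<le> sqrt (norm (A' o\<^sub>L A)) * norm x"
      by (simp add: real_sqrt_mult)
  qed simp
  then have "(norm A)\<^sup>2 \<le> (sqrt (norm (A' o\<^sub>L A)))\<^sup>2" by (intro power_mono) simp_all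
  then show "(norm A)\<^sup>2 \<le> norm (A' o\<^sub>L A)" by simp
qed

section \<open>Strong limits of operators\<close>

text \<open>Uniform boundedness by the Baire category theorem: the closed sets on which all
  \<open>X n\<close> are bounded by \<open>m\<close> cover the space, so one of them contains a ball.\<close>

lemma banach_steinhaus_sequence:
  fixes X :: "nat \<Rightarrow> ('a::banach \<Rightarrow>\<^sub>L 'b::real_normed_vector)"
  assumes "\<And>g. Bseq (\<lambda>n. X n g)"
  obtains K where "\<And>n. norm (X n) \<le> K"
proof -
  define A where "A m = {g. \<forall>n. norm (X n g) \<le> real m}" for m :: nat
  have closed: "closed (A m)" for m
    unfolding A_def
    by (intro closed_Collect_all closed_Collect_le continuous_intros)
  have cover: "\<Union> (range A) = UNIV"
  proof -
    have "\<exists>m. g \<in> A m" for g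
    proof -
      obtain K where "\<And>n. norm (X n g) \<le> K"
        using assms[of g] unfolding Bseq_def by blast
      moreover obtain m :: nat where "K \<le> real m" using real_arch_simple by blast
      ultimately have "g \<in> A m" unfolding A_def by (blast intro: order_trans)
      then show ?thesis ..
    qed
    then show ?thesis by blast
  qed
  have "\<exists>m. interior (A m) \<noteq> {}"
  proof (rule ccontr)
    assume *: "\<nexists>m. interior (A m) \<noteq> {}"
    have "Met_TC.mtopology interior_of \<Union> (range A) = {}"
    proof (rule Met_TC.metric_Baire_category_alt)
      show "Met_TC.mcomplete TYPE('a)" by (simp add: mcomplete_iff_complete complete_UNIV)
    qed (use * closed in auto)
    then show False unfolding cover by simp
  qed
  then obtain m x r where r: "r > 0" "cball x r \<subseteq> A m"
    by (metis equals0I mem_interior_cball)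
  have "norm (X n) \<le> 2 * real m / r" for n
  proof (rule norm_blinfun_bound)
    fix g
    show "norm (X n g) \<le> 2 * real m / r * norm g"
    proof (cases "g = 0")
      case False
      \<comment> \<open>Rescaled to the radius, \<open>g\<close> is a difference of two points of the ball.\<close>
      define h where "h = (r / norm g) *\<^sub>R g"
      have "x + h \<in> cball x r" "x \<in> cball x r"
        using False r by (simp_all add: h_def dist_norm)
      then have "norm (X n (x + h)) \<le> real m" "norm (X n x) \<le> real m"
        using r(2) unfolding A_def by blast+
      then have "norm (X n (x + h) - X n x) \<le> 2 * real m"
        using norm_triangle_ineq4[of "X n (x + h)" "X n x"] by linarith
      moreover have "X n (x + h) - X n x = (r / norm g) *\<^sub>R X n g"
        by (simp add: h_def blinfun.add_right blinfun.scaleR_right)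
      ultimately show ?thesis using False r by (simp add: field_simps)
    qed simp
  qed (use r in simp)
  then show ?thesis using that by blast
qed

lemma strongly_bounded_null_apply:
  fixes X :: "nat \<Rightarrow> ('a::banach \<Rightarrow>\<^sub>L 'b::real_normed_vector)"
  assumes X: "\<And>g. Bseq (\<lambda>n. X n g)" and y: "y \<longlonglongrightarrow> 0"
  shows "(\<lambda>n. X n (y n)) \<longlonglongrightarrow> 0"
proof -
  obtain K where K: "\<And>n. norm (X n) \<le> K"
    using banach_steinhaus_sequence[of X] X by blast
  show ?thesis
  proof (rule Lim_null_comparison)
    show "\<forall>\<^sub>F n in sequentially. norm (X n (y n)) \<le> K * norm (y n)"
      by (intro always_eventually allI order_trans[OF norm_blinfun] mult_right_mono K) simp
    show "(\<lambda>n. K * norm (y n)) \<longlonglongrightarrow> 0"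
      using y by (intro tendsto_mult_right_zero tendsto_norm_zero)
  qed
qed

text \<open>Multiplication of operators is not jointly strongly continuous, but along sequences it is, since
  strongly convergent sequences are bounded.\<close>

lemma strong_limit_apply:
  fixes X :: "nat \<Rightarrow> ('a::banach \<Rightarrow>\<^sub>L 'b::real_normed_vector)"
  assumes X: "\<And>g. (\<lambda>n. X n g) \<longlonglongrightarrow> X0 g" and y: "y \<longlonglongrightarrow> y0"
  shows "(\<lambda>n. X n (y n)) \<longlonglongrightarrow> X0 y0"
proof -
  have "(\<lambda>n. X n (y n - y0)) \<longlonglongrightarrow> 0"
    using y by (intro strongly_bounded_null_apply convergent_imp_Bseq convergentI[OF X])
      (simp add: LIM_zero_iff)
  from tendsto_add[OF this X[of y0]] show ?thesis by (simp add: blinfun.diff_right)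
qed

lemma continuous_on_nonneg_sequence:
  fixes f :: "real \<Rightarrow> 'a::topological_space"
  assumes "continuous_on {0..} f" "\<And>n. u n \<ge> 0" "t \<ge> 0" "u \<longlonglongrightarrow> t"
  shows "(\<lambda>n. f (u n)) \<longlonglongrightarrow> f t"
  using continuous_on_tendsto_compose[OF assms(1,4)] assms(2,3) by simp

section \<open>Algebraic and topological closure of von Neumann algebras\<close>

lemma is_adjoint_adj: "is_adjoint A A' \<Longrightarrow> is_adjoint A (adj A)"
  by (simp add: adj_eqI)

lemma is_adjoint_id: "is_adjoint id_blinfun id_blinfun"
  by (simp add: is_adjoint_def)

lemma commutant_compose: "A \<in> commutant S \<Longrightarrow> X \<in> commutant S \<Longrightarrow> A o\<^sub>L X \<in> commutant S"
  unfolding commutant_def clinear_op_def by (simp add: blinfun_compose_assoc)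
    (simp add: blinfun_compose_assoc[symmetric])

lemma commutant_add: "A \<in> commutant S \<Longrightarrow> X \<in> commutant S \<Longrightarrow> A + X \<in> commutant S"
  unfolding commutant_def clinear_op_def
  by (simp add: blinfun.add_left scaleC_add_right blinfun_eq_iff blinfun.add_right)

lemma commutant_uminus: "A \<in> commutant S \<Longrightarrow> - A \<in> commutant S"
  unfolding commutant_def clinear_op_def
  by (simp add: scaleC_minus_right blinfun.minus_left blinfun_eq_iff blinfun.minus_right)

lemma commutant_id: "id_blinfun \<in> commutant S"
  unfolding commutant_def clinear_op_def by (simp add: blinfun_eq_iff)

lemma commutant_zero: "0 \<in> commutant S"
  unfolding commutant_def clinear_op_def
  by (simp add: blinfun_eq_iff)

lemma closed_commutant: "closed (commutant (S :: ('a::chilbert_space \<Rightarrow>\<^sub>L 'a) set))"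
proof -
  have "commutant S = {A :: 'a \<Rightarrow>\<^sub>L 'a. \<forall>z x. A (z *\<^sub>C x) = z *\<^sub>C A x} \<inter>
      {A. \<forall>X. X \<in> S \<longrightarrow> A o\<^sub>L X = X o\<^sub>L A}"
    unfolding commutant_def clinear_op_def by auto
  moreover have "closed {A :: 'a \<Rightarrow>\<^sub>L 'a. \<forall>z x. A (z *\<^sub>C x) = z *\<^sub>C A x}"
    by (intro closed_Collect_all closed_Collect_eq continuous_intros
        bounded_linear.continuous_on[OF bounded_linear_scaleC])
  moreover have "closed {A :: 'a \<Rightarrow>\<^sub>L 'a. \<forall>X. X \<in> S \<longrightarrow> A o\<^sub>L X = X o\<^sub>L A}"
    by (intro closed_Collect_all closed_Collect_imp closed_Collect_eq open_Collect_const
        bounded_bilinear.continuous_on[OF bounded_bilinear_blinfun_compose]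
        continuous_on_id continuous_on_const)
  ultimately show ?thesis by (simp add: closed_Int)
qed

text \<open>All closure properties of \<open>B\<close> other than that under adjoints are closure properties
  of commutants.\<close>

locale vn_algebra =
  fixes B :: "('g::chilbert_space \<Rightarrow>\<^sub>L 'g) set"
  assumes vn: "von_neumann_algebra B"
begin

lemma bicommutant: "B = commutant (commutant B)"
  using vn by (simp add: von_neumann_algebra_def)

lemma compose_mem [simp]: "a \<in> B \<Longrightarrow> b \<in> B \<Longrightarrow> a o\<^sub>L b \<in> B"
  by (rule commutant_compose[of a "commutant B" b, folded bicommutant])

lemma add_mem [simp]: "a \<in> B \<Longrightarrow> b \<in> B \<Longrightarrow> a + b \<in> B"
  by (rule commutant_add[of a "commutant B" b, folded bicommutant])

lemma uminus_mem: "b \<in> B \<Longrightarrow> - b \<in> B"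
  by (rule commutant_uminus[of b "commutant B", folded bicommutant])

lemma diff_mem [simp]: "a \<in> B \<Longrightarrow> b \<in> B \<Longrightarrow> a - b \<in> B"
  using add_mem[OF _ uminus_mem, of a b] by simp

lemma id_mem [simp]: "id_blinfun \<in> B"
  by (rule commutant_id[of "commutant B", folded bicommutant])

lemma zero_mem [simp]: "0 \<in> B"
  by (rule commutant_zero[of "commutant B", folded bicommutant])

lemma closed_algebra: "closed B"
  by (rule closed_commutant[of "commutant B", folded bicommutant])

lemma clinear_mem:
  assumes "b \<in> B"
  shows "b (z *\<^sub>C g) = z *\<^sub>C b g"
proof -
  have "b \<in> commutant (commutant B)" using assms by (simp only: bicommutant[symmetric])
  then show ?thesis unfolding commutant_def[of "commutant B"] clinear_op_def by blast
qed

lemma adj_adjoint: "b \<in> B \<Longrightarrow> is_adjoint b (adj b)"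
  using vn is_adjoint_adj[of b] unfolding von_neumann_algebra_def by blast

lemma adj_mem [simp]: "b \<in> B \<Longrightarrow> adj b \<in> B"
  using vn adj_eqI[of b] unfolding von_neumann_algebra_def by auto

lemma adj_adj [simp]: "b \<in> B \<Longrightarrow> adj (adj b) = b"
  by (rule adj_eqI[OF is_adjoint_sym[OF adj_adjoint]])

lemma adj_compose [simp]: "a \<in> B \<Longrightarrow> b \<in> B \<Longrightarrow> adj (a o\<^sub>L b) = adj b o\<^sub>L adj a"
  by (intro adj_eqI is_adjoint_compose adj_adjoint)

lemma adj_id [simp]: "adj id_blinfun = id_blinfun"
  by (rule adj_eqI[OF is_adjoint_id])

lemma cinner_adj: "b \<in> B \<Longrightarrow> cinner g (adj b h) = cinner (b g) h"
  using is_adjoint_sym[OF adj_adjoint] by (simp add: is_adjoint_def)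

lemma norm_adj_le: "b \<in> B \<Longrightarrow> norm (adj b) \<le> norm b"
  by (rule norm_adjoint_le[OF adj_adjoint])

lemma scalar_op_commute: "b \<in> B \<Longrightarrow> scalar_op z o\<^sub>L b = b o\<^sub>L scalar_op z"
  by (rule blinfun_eqI) (simp add: clinear_mem)

lemma positive_adj_self: "b \<in> B \<Longrightarrow> positive_op (adj b o\<^sub>L b)"
  by (simp add: positive_op_def cinner_adj cinner_self)

text \<open>A normal functional given by the vectors \<open>g n\<close> and \<open>h n\<close> is pulled back to the one
  given by \<open>x (g n)\<close> and \<open>y (h n)\<close>. This covers both the left action on the trivial
  correspondence and the elementary CP-maps.\<close>

lemma normal_map_sandwich:
  assumes "x \<in> B" "y \<in> B"
  shows "normal_map B (\<lambda>b. adj x o\<^sub>L (b o\<^sub>L y))"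
  unfolding normal_map_def
proof (intro allI impI)
  fix \<omega> assume "normal_functional B \<omega>"
  then obtain g h :: "nat \<Rightarrow> 'g" where
    g: "summable (\<lambda>n. (norm (g n))\<^sup>2)" and h: "summable (\<lambda>n. (norm (h n))\<^sup>2)" and
    \<omega>: "\<And>b. b \<in> B \<Longrightarrow> \<omega> b = (\<Sum>n. cinner (g n) (b (h n)))"
    unfolding normal_functional_def by blast
  have bounded: "summable (\<lambda>n. (norm (a (k n)))\<^sup>2)"
    if "summable (\<lambda>n. (norm (k n))\<^sup>2)" for a :: "'g \<Rightarrow>\<^sub>L 'g" and k :: "nat \<Rightarrow> 'g"
  proof (rule summable_comparison_test')
    show "summable (\<lambda>n. (norm a)\<^sup>2 * (norm (k n))\<^sup>2)" using that by (rule summable_mult)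
    show "norm ((norm (a (k n)))\<^sup>2) \<le> (norm a)\<^sup>2 * (norm (k n))\<^sup>2" if "n \<ge> 0" for n
      using norm_blinfun[of a "k n"] by (simp add: power_mult_distrib[symmetric] power_mono)
  qed
  show "normal_functional B (\<lambda>b. \<omega> (adj x o\<^sub>L (b o\<^sub>L y)))"
    unfolding normal_functional_def
    using bounded[OF g, of x] bounded[OF h, of y] assms
    by (intro exI[of _ "\<lambda>n. x (g n)"] exI[of _ "\<lambda>n. y (h n)"]) (simp add: \<omega> cinner_adj)
qed

section \<open>The trivial product system\<close>

text \<open>Stated for every record that extends these operations, so as to serve for the fibres of the product
  system as well as for the ambient module of the strongly continuous structure.\<close>

lemma hilbert_module_algebra:
  fixes M :: "('g \<Rightarrow>\<^sub>L 'g, 'g, 'z) hmod_scheme"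
  assumes [simp]: "carr M = B" "ract M = (\<lambda>x b. x o\<^sub>L b)" "ip M = (\<lambda>x y. adj x o\<^sub>L y)"
  shows "hilbert_module B M"
proof -
  have mnorm: "mnorm M x = norm x" if "x \<in> B" for x
    using norm_adjoint_compose[OF adj_adjoint[OF that]] by (simp add: mnorm_def)
  have complete: "\<exists>x\<in>B. (\<lambda>n. mnorm M (f n - x)) \<longlonglongrightarrow> 0"
    if f: "\<And>n. f n \<in> B" and
      cauchy: "\<And>\<epsilon>. \<epsilon> > 0 \<Longrightarrow> \<exists>N. \<forall>m\<ge>N. \<forall>n\<ge>N. mnorm M (f m - f n) < \<epsilon>" for f :: "nat \<Rightarrow> _"
  proof -
    have "Cauchy f"
      using cauchy f by (intro CauchyI) (simp add: mnorm)
    then obtain x where x: "f \<longlonglongrightarrow> x"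
      using Cauchy_convergent convergent_def by blast
    then have "x \<in> B"
      using closed_sequentially[OF closed_algebra] f by blast
    moreover have "(\<lambda>n. norm (f n - x)) \<longlonglongrightarrow> 0"
      using x by (intro tendsto_norm_zero) (simp add: LIM_zero_iff)
    ultimately show ?thesis using f by (auto simp: mnorm)
  qed
  have zero: "x = 0" if "x \<in> B" "adj x o\<^sub>L x = 0" for x
    using norm_adjoint_compose[OF adj_adjoint[OF that(1)]] that(2) by simp
  have adjoint: "is_adjoint (adj x o\<^sub>L y) (adj y o\<^sub>L x)" if "x \<in> B" "y \<in> B" for x y
    using adj_adjoint[of "adj x o\<^sub>L y"] that by simp
  show ?thesis
    unfolding hilbert_module_def
    using complete
    by (auto simp: blinfun_compose_assoc positive_adj_self adjoint compose_add_left
        compose_add_right intro: zero)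
qed

text \<open>Right linearity gives \<open>\<Phi> x = \<Phi> 1 x\<close>, so \<open>\<Phi>\<close> is represented by
  \<open>(\<Phi> 1)\<^sup>*\<close>.\<close>

lemma bounded_right_linear_eq_ip:
  fixes M :: "('g \<Rightarrow>\<^sub>L 'g, 'g, 'z) hmod_scheme"
  assumes [simp]: "carr M = B" "ract M = (\<lambda>x b. x o\<^sub>L b)" "ip M = (\<lambda>x y. adj x o\<^sub>L y)"
  assumes "bounded_right_linear B M B \<Phi>"
  shows "\<exists>!y. y \<in> B \<and> (\<forall>x\<in>B. \<Phi> x = ip M y x)"
proof (rule ex1I[of _ "adj (\<Phi> id_blinfun)"])
  have mem: "\<Phi> id_blinfun \<in> B" and lin: "\<And>x b. x \<in> B \<Longrightarrow> b \<in> B \<Longrightarrow> \<Phi> (x o\<^sub>L b) = \<Phi> x o\<^sub>L b"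
    using assms(4) unfolding bounded_right_linear_def by simp_all
  have "\<Phi> x = \<Phi> id_blinfun o\<^sub>L x" if "x \<in> B" for x
    using lin[of id_blinfun x] that by simp
  moreover have "ip M (adj (\<Phi> id_blinfun)) x = \<Phi> id_blinfun o\<^sub>L x" for x
    using mem by simp
  ultimately show "adj (\<Phi> id_blinfun) \<in> B \<and> (\<forall>x\<in>B. \<Phi> x = ip M (adj (\<Phi> id_blinfun)) x)"
    using adj_mem[OF mem] by metis
  show "y = adj (\<Phi> id_blinfun)" if "y \<in> B \<and> (\<forall>x\<in>B. \<Phi> x = ip M y x)" for y
  proof -
    have "\<Phi> id_blinfun = adj y" using that by simp
    then show ?thesis using that by simp
  qed
qed

lemma self_dual_algebra:
  fixes M :: "('g \<Rightarrow>\<^sub>L 'g, 'g, 'z) hmod_scheme"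
  assumes M: "carr M = B" "ract M = (\<lambda>x b. x o\<^sub>L b)" "ip M = (\<lambda>x y. adj x o\<^sub>L y)"
  shows "self_dual B M"
  unfolding self_dual_def M(1)
proof (intro allI impI)
  fix \<Phi> assume "bounded_right_linear B M B \<Phi>"
  from ex1_implies_ex[OF bounded_right_linear_eq_ip[OF M this]]
  show "\<exists>y\<in>B. \<forall>x\<in>B. \<Phi> x = ip M y x" by (simp only: Bex_def)
qed

lemma trivial_corr_simps [simp]:
  "carr (trivial_corr B) = B" "ract (trivial_corr B) = (\<lambda>x b. x o\<^sub>L b)"
  "ip (trivial_corr B) = (\<lambda>x y. adj x o\<^sub>L y)" "lact (trivial_corr B) = (\<lambda>b x. b o\<^sub>L x)"
  by (simp_all add: trivial_corr_def)

lemma W_correspondence_trivial: "W_correspondence B (trivial_corr B)"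
proof -
  have "self_dual B (trivial_corr B)"
    by (rule self_dual_algebra) simp_all
  then show ?thesis
    unfolding W_correspondence_def trivial_corr_simps
    using hilbert_module_algebra[of "trivial_corr B"]
    by (intro conjI ballI allI)
      (simp_all add: normal_map_sandwich blinfun_compose_assoc scalar_op_commute compose_add_left
        compose_add_right)
qed

text \<open>The elementary tensors \<open>x y\<close> already exhaust \<open>B\<close>, because of
  \<open>b = 1 b\<close>.\<close>

lemma is_sd_tensor_trivial:
  "is_sd_tensor B (trivial_corr B) (trivial_corr B) (trivial_corr B) (\<lambda>x y. x o\<^sub>L y)"
proof -
  let ?S = "{x o\<^sub>L y |x y. x \<in> B \<and> y \<in> B}"
  have submodule: "closed_submodule B (trivial_corr B) B"
    unfolding closed_submodule_def by simp
  have "b \<in> ?S" if "b \<in> B" for b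
    using that id_mem compose_id(1)[of b, symmetric] by blast
  moreover have "?S \<subseteq> B" by auto
  ultimately have "?S = B" by blast
  then have "closed_span B (trivial_corr B) ?S = B"
    using submodule unfolding closed_span_def by auto
  moreover have "self_dual_extension B (trivial_corr B) B"
    unfolding self_dual_extension_def trivial_corr_simps(1)
  proof (intro conjI allI impI)
    fix \<Phi> assume "bounded_right_linear B (trivial_corr B) B \<Phi>"
    then show "\<exists>!y. y \<in> B \<and> (\<forall>x\<in>B. \<Phi> x = ip (trivial_corr B) y x)"
      by (intro bounded_right_linear_eq_ip) simp_all
  qed (use submodule W_correspondence_trivial in \<open>simp_all only: W_correspondence_def\<close>)
  ultimately show ?thesis
    unfolding is_sd_tensor_def using W_correspondence_trivial
    by (simp add: blinfun_compose_assoc)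
qed

lemma bilinear_unitary_trivial: "bilinear_unitary B (trivial_corr B) (trivial_corr B) (\<lambda>b. b)"
  by (simp add: bilinear_unitary_def isometric_embedding_def)

lemma trivial_system_simps [simp]:
  "fib (trivial_system B) t = trivial_corr B" "mul (trivial_system B) s t x y = x o\<^sub>L y"
  "emb0 (trivial_system B) b = b"
  by (simp_all add: trivial_system_def)

lemma emb0_trivial: "emb0 (trivial_system B) = (\<lambda>b. b)"
  by (simp add: trivial_system_def)

lemma product_system_trivial: "product_system B (trivial_system B)"
proof -
  have "\<exists>(P :: ('g \<Rightarrow>\<^sub>L 'g, 'g) corr) tens u.
      is_sd_tensor B (trivial_corr B) (trivial_corr B) P tens \<and>
      bilinear_unitary B P (trivial_corr B) u \<and> (\<forall>x\<in>B. \<forall>y\<in>B. x o\<^sub>L y = u (tens x y))"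
    using is_sd_tensor_trivial bilinear_unitary_trivial by blast
  then show ?thesis
    unfolding product_system_def
    using W_correspondence_trivial bilinear_unitary_trivial
    by (simp add: blinfun_compose_assoc emb0_trivial)
qed

section \<open>The semigroup generates the trivial product system\<close>

text \<open>The inclusion of \<open>F t\<close> into \<open>B\<close> is a bounded right linear map, and
  \<open>e\<close> is the element of \<open>F t\<close> that represents it.\<close>

lemma product_subsystem_self_dual:
  assumes F: "product_subsystem B (trivial_system B) F" and "t \<ge> 0"
  obtains e where "e \<in> F t" "\<And>x. x \<in> F t \<Longrightarrow> x = adj e o\<^sub>L x"
proof -
  let ?M = "(trivial_corr B)\<lparr>carr := F t\<rparr>"
  have W: "W_correspondence B ?M" and sub: "F t \<subseteq> B"
    using F \<open>t \<ge> 0\<close> unfolding product_subsystem_def product_system_def by auto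
  have "norm x \<le> 1 * mnorm ?M x" if "x \<in> B" for x
    using norm_adjoint_compose[OF adj_adjoint[OF that]] by (simp add: mnorm_def)
  then have "bounded_right_linear B ?M (carr ?M) (\<lambda>x. x)"
    using sub unfolding bounded_right_linear_def by (auto intro!: exI[of _ 1])
  then have "\<exists>e\<in>carr ?M. \<forall>x\<in>carr ?M. x = ip ?M e x"
    using W unfolding W_correspondence_def self_dual_def by blast
  then show ?thesis using that by auto
qed

lemma product_subsystem_ract:
  assumes "product_subsystem B (trivial_system B) F" "t \<ge> 0" "x \<in> F t" "b \<in> B"
  shows "x o\<^sub>L b \<in> F t"
proof -
  have "hilbert_module B ((trivial_corr B)\<lparr>carr := F t\<rparr>)"
    using assms(1,2)
    unfolding product_subsystem_def product_system_def W_correspondence_def by auto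
  then show ?thesis using assms(3,4) unfolding hilbert_module_def by simp
qed

text \<open>That products stay inside the subsystem is hidden in the codomain of the unitaries: the product is
  the image of an elementary tensor under a unitary onto \<open>F (s + t)\<close>.\<close>

lemma product_subsystem_mul:
  assumes F: "product_subsystem B (trivial_system B) F" and "s \<ge> 0" "t \<ge> 0" "x \<in> F s" "y \<in> F t"
  shows "x o\<^sub>L y \<in> F (s + t)"
proof -
  let ?M = "\<lambda>t. (trivial_corr B)\<lparr>carr := F t\<rparr>"
  have "\<exists>(P :: ('g \<Rightarrow>\<^sub>L 'g, 'g) corr) tens u.
      is_sd_tensor B (?M s) (?M t) P tens \<and> bilinear_unitary B P (?M (s + t)) u \<and>
      (\<forall>x\<in>F s. \<forall>y\<in>F t. x o\<^sub>L y = u (tens x y))"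
    using F \<open>s \<ge> 0\<close> \<open>t \<ge> 0\<close> unfolding product_subsystem_def product_system_def by simp
  then obtain P :: "('g \<Rightarrow>\<^sub>L 'g, 'g) corr" and tens u where
    "is_sd_tensor B (?M s) (?M t) P tens" "bilinear_unitary B P (?M (s + t)) u"
    "\<forall>x\<in>F s. \<forall>y\<in>F t. x o\<^sub>L y = u (tens x y)"
    by (elim exE conjE)
  then show ?thesis
    using assms(4,5)
    unfolding is_sd_tensor_def bilinear_unitary_def isometric_embedding_def by simp
qed

text \<open>Strong convergence of \<open>c (s / n)\<close> to the identity forces \<open>F s = B\<close> once all these
  operators are known to lie in the right ideal \<open>F s\<close>. They do because the projection
  generating \<open>F (s / n)\<close> is its own \<open>n\<close>-th power.\<close>

lemma generating_trivial_system:
  assumes c: "sc_contractive_semigroup B c"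
  shows "generating B (trivial_system B) c"
  unfolding generating_def
proof (intro allI impI, elim conjE)
  fix F and s :: real
  assume F: "product_subsystem B (trivial_system B) F" and cF: "\<forall>t\<ge>0. c t \<in> F t" and "s \<ge> 0"
  have sub: "F t \<subseteq> B" if "t \<ge> 0" for t
    using F that unfolding product_subsystem_def by simp
  have c_mem: "c t \<in> F s" if "n > 0" "t = s / real n" for n :: nat and t
  proof -
    have "t \<ge> 0" using that \<open>s \<ge> 0\<close> by simp
    obtain e where e: "e \<in> F t" "\<And>x. x \<in> F t \<Longrightarrow> x = adj e o\<^sub>L x"
      using product_subsystem_self_dual[OF F \<open>t \<ge> 0\<close>] by blast
    have "e \<in> B" using e(1) sub \<open>t \<ge> 0\<close> by blast
    \<comment> \<open>Hence \<open>e\<close> is self-adjoint, and then idempotent.\<close>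
    have "e = adj e o\<^sub>L e" by (rule e(2)[OF e(1)])
    then have self_adjoint: "adj e = e"
      using \<open>e \<in> B\<close> by (metis adj_adj adj_compose adj_mem)
    then have idem: "e o\<^sub>L e = e" using e(2)[OF e(1)] by simp
    have "e \<in> F (real (Suc k) * t)" for k
    proof (induction k)
      case (Suc k)
      have "e o\<^sub>L e \<in> F (real (Suc k) * t + t)"
        using \<open>t \<ge> 0\<close> Suc e(1) by (intro product_subsystem_mul[OF F]) simp_all
      then show ?case by (simp add: idem algebra_simps)
    qed (simp add: e(1))
    from this[of "n - 1"] have "e \<in> F s" using that by simp
    then have "e o\<^sub>L c t \<in> F s"
      using product_subsystem_ract[OF F \<open>s \<ge> 0\<close>] cF sub \<open>t \<ge> 0\<close> by blast
    then show ?thesis using e(2)[of "c t"] cF \<open>t \<ge> 0\<close> self_adjoint by simp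
  qed
  obtain e where e: "e \<in> F s" "\<And>x. x \<in> F s \<Longrightarrow> x = adj e o\<^sub>L x"
    using product_subsystem_self_dual[OF F \<open>s \<ge> 0\<close>] by blast
  have "adj e g = g" for g
  proof -
    define r where "r n = s / real (Suc n)" for n
    have "r \<longlonglongrightarrow> 0" unfolding r_def
      by (rule tendsto_divide_0[OF tendsto_const])
        (intro filterlim_compose[OF filterlim_real_sequentially filterlim_Suc]
          filterlim_at_top_imp_at_infinity)
    moreover have "r n \<ge> 0" for n using \<open>s \<ge> 0\<close> by (simp add: r_def)
    moreover have "continuous_on {0..} (\<lambda>t. c t g)" "c 0 = id_blinfun"
      using c unfolding sc_contractive_semigroup_def by blast+
    ultimately have lim: "(\<lambda>n. c (r n) g) \<longlonglongrightarrow> g"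
      using continuous_on_nonneg_sequence[of "\<lambda>t. c t g" r 0] by simp
    have "c (r n) g = adj e (c (r n) g)" for n
      using e(2)[OF c_mem[of "Suc n" "r n"]]
      by (metis blinfun_apply_blinfun_compose r_def zero_less_Suc)
    then have "(\<lambda>n. c (r n) g) \<longlonglongrightarrow> adj e g"
      using blinfun.tendsto[OF tendsto_const lim, of "adj e"] by simp
    then show ?thesis by (rule LIMSEQ_unique[OF _ lim])
  qed
  then have "adj e = id_blinfun" by (simp add: blinfun_eq_iff)
  then have "e = id_blinfun" using e(1) sub \<open>s \<ge> 0\<close> adj_adj[of e] by auto
  then show "F s = carr (fib (trivial_system B) s)"
    using e(1) sub[OF \<open>s \<ge> 0\<close>] product_subsystem_ract[OF F \<open>s \<ge> 0\<close>, of id_blinfun] by auto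
qed

section \<open>The elementary CP-semigroup\<close>

text \<open>The double sum factors as \<open>d\<^sup>* d\<close> with \<open>d = (\<Sum>i. a i x b i)\<close>.\<close>

lemma completely_positive_sandwich:
  assumes x: "x \<in> B"
  shows "completely_positive B (\<lambda>b. adj x o\<^sub>L b o\<^sub>L x)"
proof -
  have "positive_op (\<Sum>i<n. \<Sum>j<n. adj (b i) o\<^sub>L (adj x o\<^sub>L (adj (a i) o\<^sub>L a j) o\<^sub>L x) o\<^sub>L b j)"
    if ab: "\<forall>i<n. a i \<in> B \<and> b i \<in> B" for n :: nat and a b
  proof -
    define d where "d = (\<Sum>i<n. a i o\<^sub>L (x o\<^sub>L b i))"
    have sum_mem: "(\<Sum>i<m. f i) \<in> B" if "\<And>i. i < m \<Longrightarrow> f i \<in> B" for m :: nat and f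
      using that by (induction m) simp_all
    have "d \<in> B" unfolding d_def using ab x by (intro sum_mem) simp
    have "(\<Sum>i<n. \<Sum>j<n. adj (b i) o\<^sub>L (adj x o\<^sub>L (adj (a i) o\<^sub>L a j) o\<^sub>L x) o\<^sub>L b j)
      = (\<Sum>i<n. adj (a i o\<^sub>L (x o\<^sub>L b i)) o\<^sub>L d)"
      unfolding d_def
      using ab x by (intro sum.cong refl) (simp add: blinfun_eq_iff blinfun.sum_left blinfun.sum_right)
    also have "\<dots> = adj d o\<^sub>L d"
    proof -
      have "is_adjoint d (\<Sum>i<n. adj (a i o\<^sub>L (x o\<^sub>L b i)))"
        unfolding is_adjoint_def d_def
      proof (intro allI)
        fix g h
        have "cinner g (\<Sum>i<m. f i h) = cinner (\<Sum>i<m. adj (f i) g) h"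
          if "\<And>i. i < m \<Longrightarrow> f i \<in> B" for m :: nat and f
          using that
        proof (induction m)
          case 0
          show ?case using cinner_scaleC_right[of g 0 0] cinner_scaleC_left[of 0 0 h] by simp
        next
          case (Suc m)
          then show ?case
            using is_adjoint_sym[OF adj_adjoint[of "f m"]] adj_adjoint[of "f m"]
            by (simp add: cinner_add_right cinner_add_left is_adjoint_def)
        qed
        from this[of n "\<lambda>i. a i o\<^sub>L (x o\<^sub>L b i)"]
        show "cinner g ((\<Sum>i<n. a i o\<^sub>L (x o\<^sub>L b i)) h)
          = cinner ((\<Sum>i<n. adj (a i o\<^sub>L (x o\<^sub>L b i))) g) h"
          using ab x unfolding blinfun.sum_left by simp
      qed
      then have "adj d = (\<Sum>i<n. adj (a i o\<^sub>L (x o\<^sub>L b i)))" by (rule adj_eqI)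
      then show ?thesis by (simp add: blinfun_eq_iff blinfun.sum_left)
    qed
    finally show ?thesis using positive_adj_self[OF \<open>d \<in> B\<close>] by simp
  qed
  moreover have "adj x o\<^sub>L (scalar_op z o\<^sub>L b) o\<^sub>L x = scalar_op z o\<^sub>L (adj x o\<^sub>L b o\<^sub>L x)"
    if "b \<in> B" for z b
    using x by (simp add: blinfun_eq_iff clinear_mem)
  ultimately show ?thesis
    unfolding completely_positive_def
    using x by (simp add: compose_add_left compose_add_right)
qed

text \<open>For contractions, \<open>\<parallel>(c h)\<^sup>* g - g\<parallel>\<^sup>2 \<le> 2 Re \<langle>g, g - c h g\<rangle>\<close>, which gives continuity at
  0. Contractivity then bounds the difference between the times \<open>a\<close> and
  \<open>a + h\<close> by the one between 0 and \<open>h\<close>.\<close>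

lemma adjoint_semigroup_strongly_continuous:
  assumes c: "sc_contractive_semigroup B c"
  shows "continuous_on {0..} (\<lambda>t. adj (c t) g)"
proof (rule continuous_on_sequentiallyI)
  have c_mem: "c t \<in> B" and c_contr: "norm (c t) \<le> 1" if "t \<ge> 0" for t
    using c that unfolding sc_contractive_semigroup_def by blast+
  have c0: "c 0 = id_blinfun" and c_add: "\<And>s t. s \<ge> 0 \<Longrightarrow> t \<ge> 0 \<Longrightarrow> c (s + t) = c s o\<^sub>L c t"
    and c_cont: "continuous_on {0..} (\<lambda>t. c t g)"
    using c unfolding sc_contractive_semigroup_def by blast+
  have contr: "norm (adj (c t) h) \<le> norm h" if "t \<ge> 0" for t h
    using norm_blinfun[of "adj (c t)" h] norm_adj_le[OF c_mem[OF that]] c_contr[OF that]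
      mult_right_mono[of "norm (adj (c t))" 1 "norm h"] by simp
  have step: "norm (adj (c (a + h)) g - adj (c a) g) \<le> norm (adj (c h) g - g)"
    if "a \<ge> 0" "h \<ge> 0" for a h
  proof -
    have "adj (c (a + h)) g = adj (c a) (adj (c h) g)"
      using c_add[of h a] c_mem that by (simp add: add.commute)
    then show ?thesis using contr[of a "adj (c h) g - g"] that by (simp add: blinfun.diff_right)
  qed
  have at_zero: "(norm (adj (c h) g - g))\<^sup>2 \<le> 2 * inner g (g - c h g)" if "h \<ge> 0" for h
  proof -
    have "inner (adj (c h) g) g = inner g (c h g)"
      using is_adjoint_inner[OF adj_adjoint[OF c_mem[OF that]]] by simp
    moreover have "(norm (adj (c h) g))\<^sup>2 \<le> (norm g)\<^sup>2" using contr[OF that] by simp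
    ultimately show ?thesis
      by (simp add: power2_norm_eq_inner inner_diff_left inner_diff_right inner_commute)
  qed
  fix u :: "nat \<Rightarrow> real" and t
  assume u: "\<forall>n. u n \<in> {0..}" and t: "t \<in> {0..}" and lim: "u \<longlonglongrightarrow> t"
  define h where "h n = \<bar>u n - t\<bar>" for n
  have "h \<longlonglongrightarrow> 0" unfolding h_def using lim by (intro tendsto_rabs_zero) (simp add: LIM_zero_iff)
  then have "(\<lambda>n. c (h n) g) \<longlonglongrightarrow> g"
    using continuous_on_nonneg_sequence[OF c_cont, of h 0] c0 by (simp add: h_def)
  then have "(\<lambda>n. sqrt (2 * inner g (g - c (h n) g))) \<longlonglongrightarrow> sqrt (2 * inner g (g - g))"
    by (intro tendsto_intros)
  then have bound_lim: "(\<lambda>n. sqrt (2 * inner g (g - c (h n) g))) \<longlonglongrightarrow> 0" by simp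
  have bound: "norm (adj (c (u n)) g - adj (c t) g) \<le> sqrt (2 * inner g (g - c (h n) g))" for n
  proof -
    have "norm (adj (c (u n)) g - adj (c t) g) \<le> norm (adj (c (h n)) g - g)"
    proof (cases "u n \<le> t")
      case True
      then have "t = u n + h n" by (simp add: h_def)
      then show ?thesis using step[of "u n" "h n"] u
        by (metis abs_ge_zero atLeast_iff h_def norm_minus_commute)
    next
      case False
      then have "u n = t + h n" by (simp add: h_def)
      then show ?thesis using step[of t "h n"] t by (metis abs_ge_zero atLeast_iff h_def)
    qed
    also have "\<dots> \<le> sqrt (2 * inner g (g - c (h n) g))"
      using at_zero[of "h n"] by (intro real_le_rsqrt) (simp add: h_def)
    finally show ?thesis .
  qed
  have "(\<lambda>n. adj (c (u n)) g - adj (c t) g) \<longlonglongrightarrow> 0"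
    by (rule Lim_null_comparison[OF always_eventually bound_lim]) (use bound in blast)
  then show "(\<lambda>n. adj (c (u n)) g) \<longlonglongrightarrow> adj (c t) g" by (simp add: LIM_zero_iff)
qed

lemma elementary_CP_semigroup:
  assumes c: "sc_contractive_semigroup B c"
  shows "sc_contractive_normal_CP_semigroup B (elementary_CP c)"
proof -
  have c_mem: "c t \<in> B" and c_contr: "norm (c t) \<le> 1" if "t \<ge> 0" for t
    using c that unfolding sc_contractive_semigroup_def by blast+
  have c0: "c 0 = id_blinfun" and c_add: "\<And>s t. s \<ge> 0 \<Longrightarrow> t \<ge> 0 \<Longrightarrow> c (s + t) = c s o\<^sub>L c t"
    and c_cont: "\<And>g. continuous_on {0..} (\<lambda>t. c t g)"
    using c unfolding sc_contractive_semigroup_def by blast+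
  have T: "elementary_CP c t = (\<lambda>b. adj (c t) o\<^sub>L b o\<^sub>L c t)" for t
    by (rule ext) (simp add: elementary_CP_def)
  have cp: "completely_positive B (elementary_CP c t)" if "t \<ge> 0" for t
    unfolding T using completely_positive_sandwich c_mem that by simp
  have normal: "normal_map B (elementary_CP c t)" if "t \<ge> 0" for t
    unfolding T using normal_map_sandwich[of "c t" "c t"] c_mem that
    by (simp add: blinfun_compose_assoc)
  have semigroup: "elementary_CP c (s + t) b = elementary_CP c s (elementary_CP c t b)"
    if "s \<ge> 0" "t \<ge> 0" for s t b
    using c_add[of t s] c_mem that by (simp add: T blinfun_compose_assoc add.commute)
  have contr: "norm (elementary_CP c t b) \<le> norm b" if "t \<ge> 0" for t b
  proof -
    have "norm (elementary_CP c t b) \<le> norm (adj (c t) o\<^sub>L b) * norm (c t)"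
      unfolding T by (rule norm_blinfun_compose)
    also have "\<dots> \<le> (norm (adj (c t)) * norm b) * norm (c t)"
      by (intro mult_right_mono norm_blinfun_compose) simp
    also have "\<dots> \<le> (1 * norm b) * 1"
      using norm_adj_le[OF c_mem[OF that]] c_contr[OF that] by (intro mult_mono) auto
    finally show ?thesis by simp
  qed
  have cont: "continuous_on {0..} (\<lambda>t. elementary_CP c t b g)" for b g
  proof (rule continuous_on_sequentiallyI)
    fix u :: "nat \<Rightarrow> real" and t
    assume u: "\<forall>n. u n \<in> {0..}" "t \<in> {0..}" "u \<longlonglongrightarrow> t"
    have "(\<lambda>n. adj (c (u n)) h) \<longlonglongrightarrow> adj (c t) h" for h
      using continuous_on_nonneg_sequence[OF adjoint_semigroup_strongly_continuous[OF c] _ _ u(3)] u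
      by simp
    moreover have "(\<lambda>n. c (u n) g) \<longlonglongrightarrow> c t g"
      using continuous_on_nonneg_sequence[OF c_cont _ _ u(3)] u by simp
    then have "(\<lambda>n. b (c (u n) g)) \<longlonglongrightarrow> b (c t g)"
      by (rule blinfun.tendsto[OF tendsto_const])
    ultimately show "(\<lambda>n. elementary_CP c (u n) b g) \<longlonglongrightarrow> elementary_CP c t b g"
      unfolding T blinfun_apply_blinfun_compose by (rule strong_limit_apply)
  qed
  have "elementary_CP c 0 b = b" for b by (simp add: T c0)
  then show ?thesis
    unfolding sc_contractive_normal_CP_semigroup_def normal_CP_semigroup_def
    using cp normal semigroup contr cont by blast
qed

lemma GNS_system_trivial:
  assumes c: "sc_contractive_semigroup B c"
  shows "GNS_system B (elementary_CP c) (trivial_system B) c"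
proof -
  have "product_unit (trivial_system B) c"
    using c unfolding product_unit_def sc_contractive_semigroup_def by simp
  moreover have "normal_CP_semigroup B (elementary_CP c)"
    using elementary_CP_semigroup[OF c] unfolding sc_contractive_normal_CP_semigroup_def by simp
  ultimately show ?thesis
    unfolding GNS_system_def
    using product_system_trivial generating_trivial_system[OF c]
    by (simp add: elementary_CP_def blinfun_compose_assoc)
qed

section \<open>Strongly continuous structures on the trivial product system\<close>

lemma sc_sections_trivial: "sc_sections (trivial_system B) (trivial_sc_struct B) = sc_functions B"
  by (simp add: sc_sections_def sc_functions_def trivial_sc_struct_def)

lemma unit_in_sc_functions: "sc_contractive_semigroup B c \<Longrightarrow> c \<in> sc_functions B"
  by (simp add: sc_contractive_semigroup_def sc_functions_def)

text \<open>The operators of the algebra act on the representation space itself, which the identity shows to be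
  its tensor product with the algebra; joint continuity of products is sequential continuity of
  multiplication in the strong topology.\<close>

lemma sc_structure_trivial: "sc_structure B (trivial_system B) (trivial_sc_struct B)"
proof -
  let ?S = "trivial_sc_struct B"
  have S [simp]: "iemb ?S t x = x" "atens ?S b g = b g"
    "carr (amb ?S) = B" "ract (amb ?S) = (\<lambda>x b. x o\<^sub>L b)" "ip (amb ?S) = (\<lambda>x y. adj x o\<^sub>L y)"
    for t x b g
    by (simp_all add: trivial_sc_struct_def hmod.truncate_def hmod.make_def)
  have "hilbert_module B (amb ?S)" by (rule hilbert_module_algebra) simp_all
  moreover have "self_dual B (amb ?S)"
    by (rule self_dual_algebra) simp_all
  moreover have "is_hilbert_tensor (amb ?S) (atens ?S)"
  proof -
    have "g \<in> {blinfun_apply x h |x h. x \<in> B}" for g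
      using id_mem by (intro CollectI exI[of _ id_blinfun] exI[of _ g]) simp
    then have "{blinfun_apply x h |x h. x \<in> B} = UNIV" by blast
    then show ?thesis
      unfolding is_hilbert_tensor_def by (simp add: cinner_adj)
  qed
  moreover have "isometric_embedding B (trivial_corr B) (amb ?S) (iemb ?S t)" for t
    by (simp add: isometric_embedding_def)
  moreover have "\<exists>x\<in>sc_functions B. x s = y" if "y \<in> B" for s y
    using that by (intro bexI[of _ "\<lambda>_. y"]) (simp_all add: sc_functions_def)
  moreover have "continuous_on ({0..} \<times> {0..}) (\<lambda>(s, t). x s (y t g))"
    if "x \<in> sc_functions B" "y \<in> sc_functions B" for x y :: "real \<Rightarrow> 'g \<Rightarrow>\<^sub>L 'g" and g
  proof (rule continuous_on_sequentiallyI)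
    fix u :: "nat \<Rightarrow> real \<times> real" and p
    assume u: "\<forall>n. u n \<in> {0..} \<times> {0..}" "p \<in> {0..} \<times> {0..}" "u \<longlonglongrightarrow> p"
    have "(\<lambda>n. x (fst (u n)) h) \<longlonglongrightarrow> x (fst p) h" for h
      using that(1) u continuous_on_nonneg_sequence[OF _ _ _ tendsto_fst[OF u(3)], of "\<lambda>t. x t h"]
      by (simp add: sc_functions_def mem_Times_iff)
    moreover have "(\<lambda>n. y (snd (u n)) g) \<longlonglongrightarrow> y (snd p) g"
      using that(2) u continuous_on_nonneg_sequence[OF _ _ _ tendsto_snd[OF u(3)], of "\<lambda>t. y t g"]
      by (simp add: sc_functions_def mem_Times_iff)
    ultimately show "(\<lambda>n. case u n of (s, t) \<Rightarrow> x s (y t g)) \<longlonglongrightarrow> (case p of (s, t) \<Rightarrow> x s (y t g))"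
      unfolding case_prod_beta by (rule strong_limit_apply)
  qed
  ultimately show ?thesis
    unfolding sc_structure_def sc_sections_trivial by simp
qed

text \<open>The value \<open>W t x g\<close> is \<open>i\<^sub>t x \<odot> g\<close>. Its inner products depend on the vectors
  \<open>x g\<close> only, so that \<open>W t x g = V t (x g)\<close> for the isometry
  \<open>V t = W t 1\<close>; everything reduces to strong continuity of \<open>V\<close>, the fact
  \<open>id_cont\<close> below.\<close>

lemma sc_sections_unique:
  fixes S :: "('g \<Rightarrow>\<^sub>L 'g, 'h::ab_group_add, 'g, 'k::chilbert_space) sc_struct"
  assumes c: "sc_contractive_semigroup B c"
    and S: "sc_structure B (trivial_system B) S" and c_section: "c \<in> sc_sections (trivial_system B) S"
  shows "sc_sections (trivial_system B) S = sc_functions B"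
proof -
  define W where "W t x g = atens S (iemb S t x) g" for t x g
  have sections: "x \<in> sc_sections (trivial_system B) S \<longleftrightarrow>
      (\<forall>t\<ge>0. x t \<in> B) \<and> (\<forall>g. continuous_on {0..} (\<lambda>t. W t (x t) g))" for x
    unfolding sc_sections_def W_def by simp
  have W_cinner: "cinner (W t x g) (W t y h) = cinner (x g) (y h)"
    if "t \<ge> 0" "x \<in> B" "y \<in> B" for t x y g h
    using S that unfolding sc_structure_def is_hilbert_tensor_def isometric_embedding_def W_def
    by (simp add: cinner_adj)
  have W_norm: "norm (W t x g - W t y h) = norm (x g - y h)"
    if "t \<ge> 0" "x \<in> B" "y \<in> B" for t x y g h
    using that by (intro norm_diff_eq_if_cinner_eq W_cinner)
  have W_eq: "W t x g = W t id_blinfun (x g)" if "t \<ge> 0" "x \<in> B" for t x g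
    using W_norm[of t x id_blinfun g "x g"] that by simp
  have W_transfer: "(\<lambda>n. W (u n) (x n) g) \<longlonglongrightarrow> l \<longleftrightarrow> (\<lambda>n. W (u n) (y n) h) \<longlonglongrightarrow> l"
    if "\<And>n. u n \<ge> 0" "\<And>n. x n \<in> B" "\<And>n. y n \<in> B" "(\<lambda>n. x n g - y n h) \<longlonglongrightarrow> 0" for u x y g h l
  proof -
    have "(\<lambda>n. W (u n) (x n) g - W (u n) (y n) h) \<longlonglongrightarrow> 0"
      using that(4) by (subst tendsto_norm_zero_iff[symmetric])
        (simp add: W_norm that tendsto_norm_zero_iff)
    then show ?thesis by (rule Lim_transform_eq)
  qed
  have c_mem: "c t \<in> B" if "t \<ge> 0" for t
    using c that unfolding sc_contractive_semigroup_def by blast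
  have c0: "c 0 = id_blinfun" and c_cont: "\<And>g. continuous_on {0..} (\<lambda>t. c t g)"
    using c unfolding sc_contractive_semigroup_def by blast+
  have joint: "(\<lambda>n. W (a n + b n) (x (a n) o\<^sub>L c (b n)) g) \<longlonglongrightarrow> W s (x s) g"
    if x: "x \<in> sc_sections (trivial_system B) S" and "\<And>n. a n \<ge> 0" "\<And>n. b n \<ge> 0" "s \<ge> 0"
      "a \<longlonglongrightarrow> s" "b \<longlonglongrightarrow> 0" for x a b s g
  proof -
    have "continuous_on ({0..} \<times> {0..}) (\<lambda>(s, t). W (s + t) (x s o\<^sub>L c t) g)"
      using S x c_section unfolding sc_structure_def W_def by simp
    from continuous_on_tendsto_compose[OF this tendsto_Pair[OF that(5,6)]]
    show ?thesis using that(2-4) by (simp add: c0)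
  qed
  have id_cont: "(\<lambda>n. W (u n) id_blinfun g) \<longlonglongrightarrow> W s id_blinfun g"
    if u: "\<And>n. u n \<ge> 0" "s \<ge> 0" "u \<longlonglongrightarrow> s" for u s g
  proof -
    obtain x where x: "x \<in> sc_sections (trivial_system B) S" "x s = id_blinfun"
      using S \<open>s \<ge> 0\<close> unfolding sc_structure_def
      by (metis id_mem trivial_corr_simps(1) trivial_system_simps(1))
    have x_mem: "x t \<in> B" if "t \<ge> 0" for t using x that sections by blast
    \<comment> \<open>The product section at \<open>(a n, u n - a n)\<close> treats both sides of \<open>s\<close> at once: the time
      \<open>a n\<close> approaches \<open>s\<close> from the left, where \<open>x\<close> is controlled, and the rest is
      left to \<open>c\<close> near time 0.\<close>
    define a where "a n = min (u n) s" for n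
    have a: "a n \<ge> 0" "a n \<le> s" "a n \<le> u n" for n using u by (simp_all add: a_def)
    have a_lim: "a \<longlonglongrightarrow> s"
      using tendsto_min[OF u(3) tendsto_const[of s]] by (simp add: a_def[abs_def])
    have strong: "(\<lambda>n. x (a n) h) \<longlonglongrightarrow> id_blinfun h" for h
    proof -
      have b: "s - a n \<ge> 0" for n using a by simp
      have b_lim: "(\<lambda>n. s - a n) \<longlonglongrightarrow> 0"
        using tendsto_diff[OF tendsto_const[of s] a_lim] by simp
      \<comment> \<open>The products at \<open>(a n, s - a n)\<close> all lie in the fibre at \<open>s\<close>, where \<open>V s\<close> is fixed.\<close>
      have "(\<lambda>n. W s (x (a n) o\<^sub>L c (s - a n)) h) \<longlonglongrightarrow> W s id_blinfun h"
        using joint[OF x(1) a(1) b \<open>s \<ge> 0\<close> a_lim b_lim, of h] by (simp add: x(2))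
      then have "(\<lambda>n. norm (W s (x (a n) o\<^sub>L c (s - a n)) h - W s id_blinfun h)) \<longlonglongrightarrow> 0"
        by (simp add: tendsto_norm_zero_iff LIM_zero_iff)
      then have "(\<lambda>n. norm (x (a n) (c (s - a n) h) - h)) \<longlonglongrightarrow> 0"
        using W_norm x_mem[OF a(1)] c_mem[OF b] \<open>s \<ge> 0\<close> by simp
      then have 1: "(\<lambda>n. x (a n) (c (s - a n) h)) \<longlonglongrightarrow> h"
        by (simp add: tendsto_norm_zero_iff LIM_zero_iff)
      \<comment> \<open>To remove the factor \<open>c (s - a n)\<close>, boundedness of \<open>x (a n)\<close> is needed; it follows
        from continuity of the section \<open>x\<close>, as \<open>V\<close> is isometric.\<close>
      have bdd: "Bseq (\<lambda>n. x (a n) k)" for k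
      proof -
        have "(\<lambda>n. W (a n) (x (a n)) k) \<longlonglongrightarrow> W s (x s) k"
          using x(1) sections
            continuous_on_nonneg_sequence[OF _ a(1) \<open>s \<ge> 0\<close> a_lim, of "\<lambda>t. W t (x t) k"]
          by blast
        then have "Bseq (\<lambda>n. W (a n) (x (a n)) k)"
          by (intro convergent_imp_Bseq) (rule convergentI)
        moreover have "norm (W (a n) (x (a n)) k) = norm (x (a n) k)" for n
          using W_cinner[OF a(1)[of n] x_mem[OF a(1)[of n]] x_mem[OF a(1)[of n]], of k k]
          unfolding cinner_self of_real_eq_iff by (simp add: power2_eq_iff_nonneg)
        ultimately show ?thesis by (simp add: Bseq_def)
      qed
      have "(\<lambda>n. c (s - a n) h) \<longlonglongrightarrow> h"
        using continuous_on_nonneg_sequence[OF c_cont b order_refl b_lim, of h] by (simp add: c0)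
      then have "(\<lambda>n. h - c (s - a n) h) \<longlonglongrightarrow> 0"
        using tendsto_diff[OF tendsto_const[of h]] by fastforce
      then have "(\<lambda>n. x (a n) (h - c (s - a n) h)) \<longlonglongrightarrow> 0"
        by (rule strongly_bounded_null_apply[OF bdd])
      from tendsto_add[OF this 1] show ?thesis by (simp add: blinfun.diff_right)
    qed
    have d: "u n - a n \<ge> 0" for n using a by simp
    have d_lim: "(\<lambda>n. u n - a n) \<longlonglongrightarrow> 0"
      using tendsto_diff[OF u(3) a_lim] by simp
    have "(\<lambda>n. W (u n) (x (a n) o\<^sub>L c (u n - a n)) g) \<longlonglongrightarrow> W s id_blinfun g"
      using joint[OF x(1) a(1) d \<open>s \<ge> 0\<close> a_lim d_lim, of g] by (simp add: x(2))
    moreover have "(\<lambda>n. c (u n - a n) g) \<longlonglongrightarrow> g"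
      using continuous_on_nonneg_sequence[OF c_cont d order_refl d_lim, of g] by (simp add: c0)
    then have "(\<lambda>n. x (a n) (c (u n - a n) g)) \<longlonglongrightarrow> id_blinfun g"
      by (rule strong_limit_apply[OF strong])
    then have "(\<lambda>n. (x (a n) o\<^sub>L c (u n - a n)) g - id_blinfun g) \<longlonglongrightarrow> 0"
      by (simp add: LIM_zero_iff)
    ultimately show ?thesis
      using W_transfer[of u "\<lambda>n. x (a n) o\<^sub>L c (u n - a n)" "\<lambda>n. id_blinfun" g g] u(1)
        x_mem[OF a(1)] c_mem[OF d] by simp
  qed
  have "continuous_on {0..} (\<lambda>t. W t (x t) g) \<longleftrightarrow> continuous_on {0..} (\<lambda>t. x t g)"
    if x: "\<forall>t\<ge>0. x t \<in> B" for x g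
  proof -
    have "(\<lambda>n. W (u n) (x (u n)) g) \<longlonglongrightarrow> W s (x s) g \<longleftrightarrow> (\<lambda>n. x (u n) g) \<longlonglongrightarrow> x s g"
      if u: "\<And>n. u n \<ge> 0" "s \<ge> 0" "u \<longlonglongrightarrow> s" for u s
    proof -
      have lim: "(\<lambda>n. W (u n) id_blinfun (x s g)) \<longlonglongrightarrow> W s (x s) g"
        using id_cont[OF u] W_eq[of s "x s" g] x u(2) by simp
      have "norm (W (u n) (x (u n)) g - W (u n) id_blinfun (x s g)) = norm (x (u n) g - x s g)" for n
        using W_norm[of "u n" "x (u n)" id_blinfun g "x s g"] u(1) x by simp
      then have "(\<lambda>n. W (u n) (x (u n)) g - W (u n) id_blinfun (x s g)) \<longlonglongrightarrow> 0 \<longleftrightarrow>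
          (\<lambda>n. x (u n) g - x s g) \<longlonglongrightarrow> 0"
        by (metis (no_types, lifting) tendsto_norm_zero_iff ext)
      moreover have "(\<lambda>n. W (u n) (x (u n)) g) \<longlonglongrightarrow> W s (x s) g \<longleftrightarrow>
          (\<lambda>n. W (u n) (x (u n)) g - W (u n) id_blinfun (x s g)) \<longlonglongrightarrow> 0"
      proof
        assume "(\<lambda>n. W (u n) (x (u n)) g) \<longlonglongrightarrow> W s (x s) g"
        from tendsto_diff[OF this lim]
        show "(\<lambda>n. W (u n) (x (u n)) g - W (u n) id_blinfun (x s g)) \<longlonglongrightarrow> 0" by simp
      next
        assume "(\<lambda>n. W (u n) (x (u n)) g - W (u n) id_blinfun (x s g)) \<longlonglongrightarrow> 0"
        from tendsto_add[OF this lim]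
        show "(\<lambda>n. W (u n) (x (u n)) g) \<longlonglongrightarrow> W s (x s) g" by simp
      qed
      ultimately show ?thesis by (simp add: LIM_zero_iff)
    qed
    then show ?thesis unfolding continuous_on_sequentially o_def by simp
  qed
  then show ?thesis unfolding set_eq_iff sections sc_functions_def by blast
qed

end

theorem corollaryA14:
  fixes B :: "('g::chilbert_space \<Rightarrow>\<^sub>L 'g) set"
    and c :: "real \<Rightarrow> 'g \<Rightarrow>\<^sub>L 'g"
  assumes "von_neumann_algebra B"
    and "sc_contractive_semigroup B c"
  shows "sc_GNS_system B (elementary_CP c) (trivial_system B) c (trivial_sc_struct B) \<and>
    sc_sections (trivial_system B) (trivial_sc_struct B) = sc_functions B \<and>
    (\<forall>S :: ('g \<Rightarrow>\<^sub>L 'g, 'h::ab_group_add, 'g, 'k::chilbert_space) sc_struct.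
      sc_structure B (trivial_system B) S \<and> c \<in> sc_sections (trivial_system B) S \<longrightarrow>
      sc_sections (trivial_system B) S = sc_functions B)"
proof -
  interpret vn_algebra B using assms(1) by unfold_locales
  show ?thesis
  proof (intro conjI allI impI)
    show "sc_GNS_system B (elementary_CP c) (trivial_system B) c (trivial_sc_struct B)"
      unfolding sc_GNS_system_def
      using elementary_CP_semigroup GNS_system_trivial sc_structure_trivial unit_in_sc_functions
        assms(2) by (simp add: sc_sections_trivial)
    show "sc_sections (trivial_system B) (trivial_sc_struct B) = sc_functions B"
      by (rule sc_sections_trivial)
  qed (elim conjE, rule sc_sections_unique[OF assms(2)])
qed

end
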